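(* Let $(r,s)\in\mathbb{R}^2\setminus\frac12\mathbb{Z}^2$. Then for every $\tau_0\in\mathbb{H}$ with $t(\tau_0)\in\mathbb{R}\setminus\{0,1\}$, the value $\wp(p_{r,s}(\tau_0)|\tau_0)$ is finite. Equivalently, every branch of the solution $\lambda_{r,s}(t)$ of PVI$(\frac98,-\frac18,\frac18,\frac38)$ is holomorphic (has no poles) on $\mathbb{R}\setminus\{0,1\}$. In other words, every unitary solution of PVI$(\frac98,-\frac18,\frac18,\frac38)$ has no poles in $\mathbb{R}\setminus\{0,1\}$.
   Context: PVI$(\alpha,\beta,\gamma,\delta)$ is the Painlevé VI equation $\lambda''=\frac12\big(\frac1\lambda+\frac1{\lambda-1}+\frac1{\lambda-t}\big)(\lambda')^2-\big(\frac1t+\frac1{t-1}+\frac1{\lambda-t}\big)\lambda'+\frac{\lambda(\lambda-1)(\lambda-t)}{t^2(t-1)^2}\big[\alpha+\beta\frac{t}{\lambda^2}+\gamma\frac{t-1}{(\lambda-1)^2}+\delta\frac{t(t-1)}{(\lambda-t)^2}\big]$; its solutions are multivalued meromorphic functions on $\mathbb{C}\setminus\{0,1\}$. Notation: $\mathbb{H}$ is the upper half plane; for $\tau\in\mathbb{H}$, $\Lambda_\tau=\mathbb{Z}+\mathbb{Z}\tau$, $\wp(z|\tau)$ is the Weierstrass $\wp$-function with periods $1,\tau$, $\zeta(z|\tau)$ the Weierstrass zeta function ($\zeta'=-\wp$), with quasi-periods $\eta_1(\tau),\eta_2(\tau)$ defined by $\zeta(z+1)=\zeta(z)+\eta_1$,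 $\zeta(z+\tau)=\zeta(z)+\eta_2$; $e_1=\wp(\frac12|\tau)$, $e_2=\wp(\frac\tau2|\tau)$, $e_3=\wp(\frac{1+\tau}2|\tau)$; $g_2,g_3$ are defined by $\wp'^2=4\wp^3-g_2\wp-g_3$. Set $t(\tau)=\frac{e_3(\tau)-e_1(\tau)}{e_2(\tau)-e_1(\tau)}$. For $(r,s)\in\mathbb{C}^2\setminus\frac12\mathbb{Z}^2$, put $\alpha=\alpha(\tau)=r+s\tau$, $Z_{r,s}(\tau)=\zeta(r+s\tau|\tau)-r\eta_1(\tau)-s\eta_2(\tau)$, and define the meromorphic function $\wp(p_{r,s}(\tau)|\tau)$ on $\mathbb{H}$ by $\wp(p_{r,s}(\tau)|\tau)=\wp(\alpha)+\frac{3\wp'(\alpha)Z_{r,s}^2+(12\wp(\alpha)^2-g_2)Z_{r,s}+3\wp(\alpha)\wp'(\alpha)}{2(Z_{r,s}^3-3\wp(\alpha)Z_{r,s}-\wp'(\alpha))}$ (all $\wp$'s with period lattice $\Lambda_\tau$). The function $\lambda_{r,s}$ defined by $\lambda_{r,s}(t(\tau))=\frac{\wp(p_{r,s}(\tau)|\tau)-e_1(\tau)}{e_2(\tau)-e_1(\tau)}$ is a (multivalued) solution of PVI$(\frac98,-\frac18,\frac18,\frac38)$; its poles in $\mathbb{C}\setminus\{0,1\}$ are the values $t(\tau_0)$ at $\tau_0$ where $\wp(p_{r,s}(\tau_0)|\tau_0)=\infty$. It is known (from the literature) that the solutions of PVI$(\frac98,-\frac18,\frac18,\frac38)$ whose associated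 generalized Lamé equation has monodromy group conjugate into $SU(2)$ ("unitary solutions") are exactly the $\lambda_{r,s}$ with $(r,s)\in\mathbb{R}^2\setminus\frac12\mathbb{Z}^2$. *)

theory Defs
  imports "HOL-Analysis.Analysis"
begin

definition lat :: "complex \<Rightarrow> int \<times> int \<Rightarrow> complex" where
  "lat tau p = of_int (fst p) + of_int (snd p) * tau"

definition wp :: "complex \<Rightarrow> complex \<Rightarrow> complex" where
  "wp tau z = 1 / z^2 +
     infsum (\<lambda>p. 1 / (z - lat tau p)^2 - 1 / (lat tau p)^2) (UNIV - {(0,0)})"

definition wp' :: "complex \<Rightarrow> complex \<Rightarrow> complex" where
  "wp' tau z = deriv (wp tau) z"

text \<open>Weierstrass zeta function (zeta' = - wp).\<close>
definition wzeta :: "complex \<Rightarrow> complex \<Rightarrow> complex" where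
  "wzeta tau z = 1 / z +
     infsum (\<lambda>p. 1 / (z - lat tau p) + 1 / lat tau p + z / (lat tau p)^2) (UNIV - {(0,0)})"

text \<open>Quasi-periods: zeta(z+1) = zeta(z) + eta1, zeta(z+tau) = zeta(z) + eta2 (evaluated at z = -1/2, z = -tau/2).\<close>
definition eta1 :: "complex \<Rightarrow> complex" where
  "eta1 tau = wzeta tau (1/2) - wzeta tau (-1/2)"

definition eta2 :: "complex \<Rightarrow> complex" where
  "eta2 tau = wzeta tau (tau/2) - wzeta tau (-tau/2)"

text \<open>Invariant g2 (wp'^2 = 4 wp^3 - g2 wp - g3).\<close>
definition g2 :: "complex \<Rightarrow> complex" where
  "g2 tau = 60 * infsum (\<lambda>p. 1 / (lat tau p)^4) (UNIV - {(0,0)})"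

definition e1 :: "complex \<Rightarrow> complex" where "e1 tau = wp tau (1/2)"
definition e2 :: "complex \<Rightarrow> complex" where "e2 tau = wp tau (tau/2)"
definition e3 :: "complex \<Rightarrow> complex" where "e3 tau = wp tau ((1 + tau)/2)"

definition tfun :: "complex \<Rightarrow> complex" where
  "tfun tau = (e3 tau - e1 tau) / (e2 tau - e1 tau)"

definition Zrs :: "real \<Rightarrow> real \<Rightarrow> complex \<Rightarrow> complex" where
  "Zrs r s tau = wzeta tau (of_real r + of_real s * tau) - of_real r * eta1 tau - of_real s * eta2 tau"

definition wp_p :: "real \<Rightarrow> real \<Rightarrow> complex \<Rightarrow> complex" where
  "wp_p r s tau =
     (let a = of_real r + of_real s * tau; P = wp tau a; P' = wp' tau a; Z = Zrs r s tau
      in P + (3 * P' * Z^2 + (12 * P^2 - g2 tau) * Z + 3 * P * P') / (2 * (Z^3 - 3 * P * Z - P')))"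

end

theory Submission
  imports Defs "HOL-Complex_Analysis.Complex_Analysis"
begin

text \<open>
  All ingredients of \<open>wp_p r s\<close> are continuous in the modulus, so a pole can only come from a zero of
  the denominator \<open>T = Z\<^sup>3 - 3 \<wp> Z - \<wp>'\<close>. This \<open>T\<close> does not vanish when the lattice is
  rectangular, and a real value of \<open>tfun\<close> forces the lattice to be similar to a rectangular one.

  Write \<open>a = r + s\<tau>\<close>, \<open>\<xi>\<^sub>k(a) = exp(2\<pi>i(a + k\<tau>))\<close> and \<open>L(x) = x / (1 - x)\<close>. Since \<open>T\<close> is a twisted
  Eisenstein series of weight 3, it has the Lambert expansion
  \<open>T = 24 \<pi>\<^sup>3 i (\<Sum>\<^sub>k\<^sub>\<ge>\<^sub>0 (k + s)\<^sup>2 L(\<xi>\<^sub>k(a)) - \<Sum>\<^sub>k\<^sub>\<ge>\<^sub>1 (k - s)\<^sup>2 L(\<xi>\<^sub>k(-a)) - (s - 3s\<^sup>2 + 2s\<^sup>3)/6)\<close>,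
  which follows from Liouville's theorem by comparing quasi-periods and singular parts.
  For purely imaginary \<open>\<tau>\<close> every term contributes to the real part of \<open>T\<close> with the sign of
  \<open>- sin(2\<pi>r)\<close>, so \<open>T = 0\<close> forces \<open>2r \<in> \<int>\<close>; the same argument for \<open>-1/\<tau>\<close> forces \<open>2s \<in> \<int>\<close>.

  If \<open>tfun\<close> is real, then \<open>e1, e2, e3\<close> lie on a real line through 0. After a rotation,
  \<open>\<wp>\<close> and its complex conjugate solve \<open>\<wp>'' = 6\<wp>\<^sup>2 + K\<close> with the same initial data at each half period,
  so they coincide; comparing poles shows that the lattice is rectangular.
\<close>

section \<open>Lattices in the complex plane\<close>

text \<open>Legendre's relation gives Z = \<open>zeta_hat a\<close> + 2 pi i s. Hence T is a cubic
  polynomial in s whose coefficients are combinations of \<open>zeta_hat\<close>, \<open>wp\<close>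
  and \<open>wp'\<close>. In each of them the poles cancel against those of one Lambert sum, so the
  Liouville argument treats one coefficient at a time. The polynomial in s that remains is B_3(s)/3,
  with B_3 the third Bernoulli polynomial; it is real and does not disturb the sign argument.

  That argument sees only r: for imaginary tau every xi_k(a) has argument 2 pi r. Exchanging the
  sides of the rectangle exchanges the roles of r and s, which is why a second modulus enters. The
  transfer works because T depends on the point a and the lattice, not on the basis, and is
  homogeneous under scaling.

  The obstacle in the other half is that a lattice with a mirror symmetry can also be rhombic.
  Reflecting about a half period h instead of 0 excludes this: it puts h - cnj(eps h) into the
  lattice, which is half of what the symmetry about 0 would give for the period 2h.\<close>

abbreviation lattice :: "complex \<Rightarrow> complex set" where
  "lattice tau \<equiv> range (lat tau)"

lemma lat_eq: "lat tau (m, n) = of_int m + of_int n * tau"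
  by (simp add: lat_def)

text \<open>The imaginary part controls |y|, and the triangle inequality then controls |x|. The
  constant depends on \<open>tau\<close> only through \<open>d\<close> and \<open>R\<close>, so the
  same estimate serves a single lattice and a whole neighbourhood of moduli.\<close>

lemma l1_norm_le_norm_combination:
  fixes x y :: real
  assumes "d > 0" "Im tau \<ge> d" "norm tau \<le> R"
  shows "\<bar>x\<bar> + \<bar>y\<bar> \<le> (1 + (R + 1) / d) * norm (of_real x + of_real y * tau)"
proof -
  let ?N = "norm (of_real x + of_real y * tau)"
  have "R \<ge> 0" using assms(3) norm_ge_zero[of tau] by linarith
  have "\<bar>y\<bar> * d \<le> \<bar>y\<bar> * Im tau"
    using assms by (intro mult_left_mono) auto
  also have "\<dots> = \<bar>Im (of_real x + of_real y * tau)\<bar>"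
    using assms by (simp add: abs_mult)
  also have "\<dots> \<le> ?N" by (rule abs_Im_le_cmod)
  finally have y: "\<bar>y\<bar> \<le> ?N / d" using assms(1) by (simp add: field_simps)
  have "\<bar>x\<bar> = norm ((of_real x + of_real y * tau) - of_real y * tau)"
    by simp
  also have "\<dots> \<le> ?N + \<bar>y\<bar> * norm tau"
    using norm_triangle_ineq4[of "of_real x + of_real y * tau" "of_real y * tau"]
    by (simp add: norm_mult)
  also have "\<dots> \<le> ?N + \<bar>y\<bar> * R"
    using assms by (intro add_left_mono mult_left_mono) auto
  finally have "\<bar>x\<bar> + \<bar>y\<bar> \<le> ?N + \<bar>y\<bar> * (R + 1)" by (simp add: algebra_simps)
  also have "\<dots> \<le> ?N + (?N / d) * (R + 1)"
    using y \<open>R \<ge> 0\<close> by (intro add_left_mono mult_right_mono) auto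
  finally show ?thesis by (simp add: algebra_simps add_divide_distrib)
qed

lemma summable_on_int_powr:
  "(\<lambda>m::int. (1 + \<bar>real_of_int m\<bar>) powr (-3/2)) summable_on UNIV"
proof -
  let ?f = "\<lambda>m::int. (1 + \<bar>real_of_int m\<bar>) powr (-3/2)"
  have "summable (\<lambda>n. real n powr (-3/2))"
    by (simp add: summable_real_powr_iff)
  then have "summable (\<lambda>n. real (Suc n) powr (-3/2))"
    by (subst summable_Suc_iff)
  then have s: "(\<lambda>n::nat. (1 + real n) powr (-3/2)) summable_on UNIV"
    by (subst summable_on_UNIV_nonneg_real_iff) auto
  have 1: "?f summable_on (range int)"
    by (subst summable_on_reindex) (use s in \<open>auto simp: o_def inj_on_def\<close>)
  have 2: "?f summable_on (range (\<lambda>n. - int n))"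
    by (subst summable_on_reindex) (use s in \<open>auto simp: o_def inj_on_def\<close>)
  have "range int \<union> range (\<lambda>n. - int n) = UNIV"
  proof (intro set_eqI iffI UNIV_I)
    fix x :: int
    show "x \<in> range int \<union> range (\<lambda>n. - int n)"
      by (cases x rule: int_cases2) auto
  qed
  with summable_on_union[OF 1 2] show ?thesis by simp
qed

text \<open>Away from the origin the inequality of arithmetic and geometric means gives
  (1+|m|)(1+|n|) \<le> (3(|m|+|n|))^2. Its power 3/2 dominates the double series by a product of two
  single series with exponent 3/2 > 1; the cube of 3 is the factor 27.\<close>

lemma summable_on_inverse_cube_l1_norm:
  "(\<lambda>p::int\<times>int. 1 / (\<bar>real_of_int (fst p)\<bar> + \<bar>real_of_int (snd p)\<bar>) ^ 3) summable_on (UNIV - {(0,0)})"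
proof (rule summable_on_comparison_test)
  let ?f = "\<lambda>m::int. (1 + \<bar>real_of_int m\<bar>) powr (-3/2)"
  have "(\<lambda>p. ?f (fst p) * ?f (snd p)) summable_on (UNIV \<times> UNIV)"
  proof (rule summable_on_SigmaI[where g = "\<lambda>m. ?f m * infsum ?f UNIV"])
    show "((\<lambda>n. ?f (fst (m, n)) * ?f (snd (m, n))) has_sum ?f m * infsum ?f UNIV) UNIV" for m :: int
      using has_sum_cmult_right[OF has_sum_infsum[OF summable_on_int_powr], of "?f m"] by simp
    show "(\<lambda>m. ?f m * infsum ?f UNIV) summable_on UNIV"
      by (intro summable_on_cmult_left summable_on_int_powr)
  qed auto
  then have "(\<lambda>p. 27 * (?f (fst p) * ?f (snd p))) summable_on UNIV"
    by (intro summable_on_cmult_right) simp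
  then show "(\<lambda>p. 27 * (?f (fst p) * ?f (snd p))) summable_on (UNIV - {(0,0)})"
    by (rule summable_on_subset_banach) auto
  fix p :: "int \<times> int"
  assume p: "p \<in> UNIV - {(0,0)}"
  obtain m n where [simp]: "p = (m, n)" by (cases p)
  let ?u = "1 + \<bar>real_of_int m\<bar>" and ?v = "1 + \<bar>real_of_int n\<bar>"
  let ?s = "\<bar>real_of_int m\<bar> + \<bar>real_of_int n\<bar>"
  have "1 \<le> \<bar>m\<bar> + \<bar>n\<bar>" using p by auto
  then have s1: "1 \<le> ?s" by linarith
  have "sqrt (?u * ?v) \<le> (?u + ?v) / 2"
    by (rule arith_geo_mean_sqrt) auto
  also have "\<dots> \<le> 3 * ?s" using s1 by simp
  finally have "(?u * ?v) powr (1/2) \<le> 3 * ?s"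
    by (simp add: powr_half_sqrt)
  then have "((?u * ?v) powr (1/2)) ^ 3 \<le> (3 * ?s) ^ 3"
    by (intro power_mono) auto
  also have "((?u * ?v) powr (1/2)) ^ 3 = ((?u * ?v) powr (1/2)) powr (real 3)"
    by (rule powr_realpow[symmetric]) (auto simp: abs_if)
  also have "\<dots> = (?u * ?v) powr (3/2)"
    by (simp only: powr_powr) simp
  also have "\<dots> = ?u powr (3/2) * ?v powr (3/2)"
    by (rule powr_mult)
  also have "(3 * ?s) ^ 3 = 27 * ?s ^ 3"
    by (simp only: power_mult_distrib) simp
  finally have le: "?u powr (3/2) * ?v powr (3/2) \<le> 27 * ?s ^ 3" .
  have pos: "0 < ?u powr (3/2) * ?v powr (3/2)" by simp
  have "1 / ?s ^ 3 = 27 / (27 * ?s ^ 3)" by simp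
  also have "\<dots> \<le> 27 / (?u powr (3/2) * ?v powr (3/2))"
    using le pos by (intro divide_left_mono mult_pos_pos) (use s1 in auto)
  also have "\<dots> = 27 * (?f m * ?f n)"
    using powr_minus[of ?u "3/2"] powr_minus[of ?v "3/2"]
    by (simp only: minus_divide_left divide_inverse[of 27] inverse_mult_distrib)
  finally show "1 / (\<bar>real_of_int (fst p)\<bar> + \<bar>real_of_int (snd p)\<bar>) ^ 3 \<le> 27 * (?f (fst p) * ?f (snd p))"
    by simp
qed auto

text \<open>A majorant of the terms makes the convergence locally uniform, and for holomorphic terms
  this already allows termwise differentiation. Summability of the differentiated series comes
  along; the series of \<open>wp'\<close> is obtained in this way.\<close>

lemma infsum_has_field_derivative:
  fixes f f' :: "'a \<Rightarrow> complex \<Rightarrow> complex"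
  assumes U: "open U" "z \<in> U"
    and deriv: "\<And>p w. p \<in> I \<Longrightarrow> w \<in> U \<Longrightarrow> (f p has_field_derivative f' p w) (at w)"
    and bound: "\<And>p w. p \<in> I \<Longrightarrow> w \<in> U \<Longrightarrow> norm (f p w) \<le> M p"
    and M: "M summable_on I"
  shows "(\<lambda>p. f' p z) summable_on I"
    and "((\<lambda>w. infsum (\<lambda>p. f p w) I) has_field_derivative infsum (\<lambda>p. f' p z) I) (at z)"
proof -
  obtain r where r: "r > 0" "cball z r \<subseteq> U"
    using U open_contains_cball by blast
  have ul: "uniform_limit (cball z r) (\<lambda>X y. \<Sum>x\<in>X. f x y) (\<lambda>y. infsum (\<lambda>p. f p y) I) (finite_subsets_at_top I)"
    using bound r M by (intro Weierstrass_m_test_general) auto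
  have ev: "\<forall>\<^sub>F X in finite_subsets_at_top I. continuous_on (cball z r) (\<lambda>y. \<Sum>x\<in>X. f x y) \<and>
      (\<forall>w\<in>ball z r. ((\<lambda>y. \<Sum>x\<in>X. f x y) has_field_derivative (\<Sum>x\<in>X. f' x w)) (at w))"
  proof (rule eventually_finite_subsets_at_top_weakI, intro conjI ballI)
    fix X assume X: "finite X" "X \<subseteq> I"
    have D: "((\<lambda>y. \<Sum>x\<in>X. f x y) has_field_derivative (\<Sum>x\<in>X. f' x w)) (at w)" if "w \<in> U" for w
      using X that by (intro DERIV_sum deriv) auto
    then show "continuous_on (cball z r) (\<lambda>y. \<Sum>x\<in>X. f x y)"
      using r by (meson DERIV_atLeastAtMost_imp_continuous_on DERIV_continuous continuous_at_imp_continuous_on subsetD)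
    show "((\<lambda>y. \<Sum>x\<in>X. f x y) has_field_derivative (\<Sum>x\<in>X. f' x w)) (at w)" if "w \<in> ball z r" for w
      using D that r by (meson ball_subset_cball subsetD)
  qed
  obtain g' where g': "\<And>w. w \<in> ball z r \<Longrightarrow> ((\<lambda>y. infsum (\<lambda>p. f p y) I) has_field_derivative (g' w)) (at w) \<and>
      ((\<lambda>X. \<Sum>x\<in>X. f' x w) \<longlongrightarrow> g' w) (finite_subsets_at_top I)"
    using has_complex_derivative_uniform_limit[OF ev ul] r(1) by auto
  have hs: "((\<lambda>p. f' p z) has_sum g' z) I"
    using g'[of z] r(1) by (simp add: has_sum_def)
  then show "(\<lambda>p. f' p z) summable_on I" by (rule has_sum_imp_summable)
  show "((\<lambda>w. infsum (\<lambda>p. f p w) I) has_field_derivative infsum (\<lambda>p. f' p z) I) (at z)"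
    using g'[of z] r(1) infsumI[OF hs] by simp
qed

section \<open>The lattice spanned by 1 and a point of the upper half plane\<close>

locale upper_half_plane =
  fixes tau :: complex
  assumes Im_tau: "Im tau > 0"
begin

abbreviation \<Lambda> :: "complex set" where "\<Lambda> \<equiv> lattice tau"

text \<open>A lower bound for the length of nonzero lattice vectors, read off from the comparison
  with the l1 norm of the coordinates.\<close>

definition sep :: real where "sep = 1 / (1 + (norm tau + 1) / Im tau)"

lemma sep_pos: "sep > 0"
  unfolding sep_def using Im_tau by (intro divide_pos_pos add_pos_nonneg divide_nonneg_pos) auto

lemma sep_bound: "sep * (\<bar>x\<bar> + \<bar>y\<bar>) \<le> norm (of_real x + of_real y * tau)"
proof -
  have pos: "1 + (norm tau + 1) / Im tau > 0"
    using Im_tau by (intro add_pos_nonneg divide_nonneg_pos) auto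
  have "\<bar>x\<bar> + \<bar>y\<bar> \<le> (1 + (norm tau + 1) / Im tau) * norm (of_real x + of_real y * tau)"
    using Im_tau by (intro l1_norm_le_norm_combination) auto
  then show ?thesis using pos by (simp add: sep_def pos_divide_le_eq mult.commute)
qed

lemma combination_eq_iff:
  "of_real x + of_real y * tau = of_real x' + of_real y' * tau \<longleftrightarrow> x = x' \<and> y = y'"
proof
  assume eq: "of_real x + of_real y * tau = of_real x' + of_real y' * tau"
  have "of_real (x - x') + of_real (y - y') * tau = 0"
    using eq by (simp add: algebra_simps)
  then have "sep * (\<bar>x - x'\<bar> + \<bar>y - y'\<bar>) \<le> 0"
    using sep_bound[of "x - x'" "y - y'"] by simp
  then have "\<bar>x - x'\<bar> + \<bar>y - y'\<bar> \<le> 0"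
    using sep_pos by (simp add: mult_le_0_iff)
  then show "x = x' \<and> y = y'" by linarith
qed auto

lemma exists_combination: obtains x y :: real where "z = of_real x + of_real y * tau"
proof
  let ?y = "Im z / Im tau"
  show "z = of_real (Re z - ?y * Re tau) + of_real ?y * tau"
    using Im_tau by (simp add: complex_eq_iff)
qed

lemma lat_real: "lat tau p = of_real (of_int (fst p)) + of_real (of_int (snd p)) * tau"
  by (simp add: lat_def)

lemma combination_in_lattice_iff:
  "of_real x + of_real y * tau \<in> \<Lambda> \<longleftrightarrow> x \<in> \<int> \<and> y \<in> \<int>"
proof
  assume "of_real x + of_real y * tau \<in> \<Lambda>"
  then obtain p where "of_real x + of_real y * tau = lat tau p" by auto
  then show "x \<in> \<int> \<and> y \<in> \<int>" unfolding lat_real combination_eq_iff by auto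
next
  assume "x \<in> \<int> \<and> y \<in> \<int>"
  then obtain m n where "x = of_int m" "y = of_int n" by (auto elim!: Ints_cases)
  then have "of_real x + of_real y * tau = lat tau (m, n)" by (simp add: lat_def)
  then show "of_real x + of_real y * tau \<in> \<Lambda>" by simp
qed

lemma inj_lat: "inj (lat tau)"
  by (rule injI) (simp add: lat_real combination_eq_iff prod_eq_iff del: of_real_of_int_eq)

lemma lat_eq_0_iff: "lat tau p = 0 \<longleftrightarrow> p = (0, 0)"
  using inj_lat[THEN inj_eq, of p "(0,0)"] by (simp add: lat_eq)

lemma lat_add: "lat tau p + lat tau q = lat tau (fst p + fst q, snd p + snd q)"
  by (simp add: lat_def algebra_simps)

lemma lattice_add: "a \<in> \<Lambda> \<Longrightarrow> b \<in> \<Lambda> \<Longrightarrow> a + b \<in> \<Lambda>"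
  by (auto simp: lat_add)

lemma lat_minus: "- lat tau p = lat tau (- fst p, - snd p)"
  by (simp add: lat_def)

lemma lattice_minus: "a \<in> \<Lambda> \<Longrightarrow> - a \<in> \<Lambda>"
  by (auto simp: lat_minus)

lemma lattice_minus_iff [simp]: "- a \<in> \<Lambda> \<longleftrightarrow> a \<in> \<Lambda>"
  using lattice_minus[of a] lattice_minus[of "-a"] by auto

lemma lattice_diff: "a \<in> \<Lambda> \<Longrightarrow> b \<in> \<Lambda> \<Longrightarrow> a - b \<in> \<Lambda>"
  using lattice_add[of a "-b"] by simp

lemma lattice_int_mult: "a \<in> \<Lambda> \<Longrightarrow> of_int k * a \<in> \<Lambda>"
proof -
  assume "a \<in> \<Lambda>"
  then obtain p where "a = lat tau p" by auto
  then have "of_int k * a = lat tau (k * fst p, k * snd p)"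
    by (simp add: lat_def algebra_simps)
  then show ?thesis by simp
qed

lemma zero_in_lattice [simp]: "0 \<in> \<Lambda>"
  and one_in_lattice [simp]: "1 \<in> \<Lambda>"
  and tau_in_lattice [simp]: "tau \<in> \<Lambda>"
  using rangeI[of "lat tau" "(0,0)"] rangeI[of "lat tau" "(1,0)"] rangeI[of "lat tau" "(0,1)"]
  by (simp_all add: lat_eq)

lemma lattice_add_iff: "w \<in> \<Lambda> \<Longrightarrow> z + w \<in> \<Lambda> \<longleftrightarrow> z \<in> \<Lambda>"
  using lattice_add[of z w] lattice_diff[of "z + w" w] by auto

lemma norm_lat_ge: "p \<noteq> (0,0) \<Longrightarrow> sep \<le> norm (lat tau p)"
proof -
  assume p: "p \<noteq> (0,0)"
  then have "1 \<le> \<bar>fst p\<bar> + \<bar>snd p\<bar>" by (cases p) auto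
  then have "1 \<le> \<bar>real_of_int (fst p)\<bar> + \<bar>real_of_int (snd p)\<bar>" by linarith
  then have "sep * 1 \<le> sep * (\<bar>real_of_int (fst p)\<bar> + \<bar>real_of_int (snd p)\<bar>)"
    using sep_pos by (intro mult_left_mono) auto
  also have "\<dots> \<le> norm (lat tau p)"
    unfolding lat_real by (rule sep_bound)
  finally show ?thesis by simp
qed

lemma lattice_dist: "a \<in> \<Lambda> \<Longrightarrow> b \<in> \<Lambda> \<Longrightarrow> dist a b < sep \<Longrightarrow> a = b"
proof -
  assume "a \<in> \<Lambda>" "b \<in> \<Lambda>" and d: "dist a b < sep"
  then obtain p where p: "a - b = lat tau p" using lattice_diff by blast
  then have "p = (0,0)" using norm_lat_ge[of p] d by (auto simp: dist_norm)
  then show ?thesis using p by (simp add: lat_eq)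
qed

lemma closed_subset_lattice: "A \<subseteq> \<Lambda> \<Longrightarrow> closed A"
  by (rule discrete_imp_closed[OF sep_pos]) (blast intro: lattice_dist)

lemma closed_lattice: "closed \<Lambda>"
  by (rule closed_subset_lattice) simp

lemma open_compl_lattice: "open (- \<Lambda>)"
  using closed_lattice by (simp add: open_closed)

lemma connected_compl_lattice: "connected (- \<Lambda>)"
proof -
  have "connected (UNIV - \<Lambda>)"
    by (rule connected_open_diff_countable) (auto simp: connected_UNIV)
  then show ?thesis by (simp add: Compl_eq_Diff_UNIV)
qed

lemma half_not_in_lattice: "1/2 \<notin> \<Lambda>" "tau/2 \<notin> \<Lambda>" "(1 + tau)/2 \<notin> \<Lambda>"
proof -
  have *: "(1/2::real) \<notin> \<int>"
  proof
    assume "(1/2::real) \<in> \<int>"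
    then obtain k :: int where "(1/2::real) = of_int k" by (rule Ints_cases)
    then have "(1::real) = of_int (2 * k)" by simp
    then have "1 = 2 * k" by linarith
    then show False by presburger
  qed
  then show "1/2 \<notin> \<Lambda>" "tau/2 \<notin> \<Lambda>" "(1 + tau)/2 \<notin> \<Lambda>"
    using combination_in_lattice_iff[of "1/2" 0] combination_in_lattice_iff[of 0 "1/2"]
      combination_in_lattice_iff[of "1/2" "1/2"]
    by (simp_all add: add_divide_distrib)
qed

lemma summable_on_inverse_cube_lat:
  "(\<lambda>p. 1 / norm (lat tau p) ^ 3) summable_on (UNIV - {(0,0)})"
proof (rule summable_on_comparison_test)
  let ?s = "\<lambda>p::int\<times>int. \<bar>real_of_int (fst p)\<bar> + \<bar>real_of_int (snd p)\<bar>"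
  show "(\<lambda>p. (1 / sep ^ 3) * (1 / ?s p ^ 3)) summable_on (UNIV - {(0,0)})"
    by (intro summable_on_cmult_right summable_on_inverse_cube_l1_norm)
  fix p :: "int \<times> int" assume p: "p \<in> UNIV - {(0,0)}"
  have "1 \<le> \<bar>fst p\<bar> + \<bar>snd p\<bar>" using p by (cases p) auto
  then have s: "1 \<le> ?s p" by linarith
  have "(sep * ?s p) ^ 3 \<le> norm (lat tau p) ^ 3"
    unfolding lat_real using sep_pos s by (intro power_mono sep_bound) auto
  moreover have "(sep * ?s p) ^ 3 > 0" using sep_pos s by auto
  ultimately have "1 / norm (lat tau p) ^ 3 \<le> 1 / (sep * ?s p) ^ 3"
    by (intro divide_left_mono mult_pos_pos) auto
  then show "1 / norm (lat tau p) ^ 3 \<le> (1 / sep ^ 3) * (1 / ?s p ^ 3)"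
    by (simp add: power_mult_distrib)
qed auto

end

section \<open>The Weierstrass functions\<close>

lemma inverse_square_has_field_derivative:
  fixes w c :: complex
  assumes "w - c \<noteq> 0"
  shows "((\<lambda>w. 1 / (w - c)^2) has_field_derivative - 2 / (w - c)^3) (at w)"
proof -
  have "- (2 * u) / (u^2 * u^2) = - 2 / u^3" if "u \<noteq> 0" for u :: complex
    using that by (simp add: power2_eq_square power3_eq_cube)
  from this[OF assms] show ?thesis
    using assms by (auto intro!: derivative_eq_intros)
qed

text \<open>The equation for \<open>f\<close> is assumed only on \<open>S\<close>, usually the
  complement of a lattice, so \<open>S\<close> has to be closed under the shift in both directions
  for the induction to reach all integers.\<close>

lemma int_induct_shift:
  fixes w :: complex
  assumes "\<And>z. z \<in> S \<Longrightarrow> z + w \<in> S" "\<And>z. z \<in> S \<Longrightarrow> z - w \<in> S"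
    and f: "\<And>z. z \<in> S \<Longrightarrow> f (z + w) = f z + (k::complex)" and z: "z \<in> S"
  shows "f (z + of_int m * w) = f z + of_int m * k"
proof -
  have "z + of_int m * w \<in> S \<and> f (z + of_int m * w) = f z + of_int m * k"
  proof (induction m rule: int_induct[where k = 0])
    case (step1 i)
    then show ?case using assms(1)[of "z + of_int i * w"] f[of "z + of_int i * w"]
      by (simp add: algebra_simps)
  next
    case (step2 i)
    then show ?case using assms(2)[of "z + of_int i * w"] f[of "z + of_int (i - 1) * w"]
      by (simp add: algebra_simps)
  qed (use z in auto)
  then show ?thesis by blast
qed

section \<open>Derivatives, parity and quasi-periods of the Weierstrass functions\<close>

context upper_half_plane
begin

abbreviation I\<^sub>0 :: "(int \<times> int) set" where "I\<^sub>0 \<equiv> UNIV - {(0,0)}"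

text \<open>\<open>zeta_reg\<close>, \<open>wp_reg\<close> and \<open>wp_reg'\<close> are what is
  left after removing the principal part at 0. They are holomorphic at 0, so limits there of
  combinations of Weierstrass functions can be read off from them.\<close>

definition zeta_reg :: "complex \<Rightarrow> complex" where
  "zeta_reg z = infsum (\<lambda>p. 1 / (z - lat tau p) + 1 / lat tau p + z / (lat tau p)^2) I\<^sub>0"

definition wp_reg :: "complex \<Rightarrow> complex" where
  "wp_reg z = infsum (\<lambda>p. 1 / (z - lat tau p)^2 - 1 / (lat tau p)^2) I\<^sub>0"

definition wp_reg' :: "complex \<Rightarrow> complex" where
  "wp_reg' z = infsum (\<lambda>p. - 2 / (z - lat tau p)^3) I\<^sub>0"

lemma wzeta_eq: "wzeta tau z = 1 / z + zeta_reg z"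
  by (simp add: wzeta_def zeta_reg_def)

lemma wp_eq: "wp tau z = 1 / z^2 + wp_reg z"
  by (simp add: wp_def wp_reg_def)

lemma open_compl_nonzero_lattice: "open (- (\<Lambda> - {0}))"
  using closed_subset_lattice[of "\<Lambda> - {0}"] open_Compl by blast

text \<open>A lattice point of length at least 2R is at least half its length away from
  \<open>w\<close>, since |w| \<le> R. A shorter one is at distance at least r, because a ball of
  radius 2r around \<open>z\<close> avoids all nonzero lattice points. This explains the two entries
  of the minimum \<open>c\<close>.\<close>

lemma nonzero_lattice_separation:
  assumes "z \<notin> \<Lambda> - {0}"
  obtains r c where "r > 0" "c > 0"
    "\<And>w p. w \<in> ball z r \<Longrightarrow> p \<in> I\<^sub>0 \<Longrightarrow> c * norm (lat tau p) \<le> norm (w - lat tau p)"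
proof -
  obtain e where e: "e > 0" "ball z e \<subseteq> - (\<Lambda> - {0})"
    using assms open_compl_nonzero_lattice open_contains_ball by (metis ComplI)
  define r where "r = e / 2"
  define R where "R = norm z + r"
  define c where "c = min (1/2) (r / (2 * R))"
  have r: "r > 0" using e(1) by (simp add: r_def)
  then have R: "R > 0" by (simp add: R_def add_nonneg_pos)
  have c: "c > 0" "c \<le> 1/2" "c \<le> r / (2 * R)" using r R by (auto simp: c_def)
  have cR: "c * (2 * R) \<le> r" using c(3) R by (simp add: pos_le_divide_eq)
  show ?thesis
  proof (rule that[OF r c(1)])
    fix w p assume w: "w \<in> ball z r" and p: "p \<in> I\<^sub>0"
    have nw: "norm w \<le> R"
      using w norm_triangle_ineq2[of w z] by (simp add: R_def dist_norm norm_minus_commute)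
    show "c * norm (lat tau p) \<le> norm (w - lat tau p)"
    proof (cases "norm (lat tau p) \<ge> 2 * R")
      case True
      have "c * norm (lat tau p) \<le> 1/2 * norm (lat tau p)"
        using c by (intro mult_right_mono) auto
      also have "\<dots> \<le> norm (lat tau p) - norm w" using True nw by simp
      also have "\<dots> \<le> norm (w - lat tau p)" by (metis norm_minus_commute norm_triangle_ineq2)
      finally show ?thesis .
    next
      case False
      have "lat tau p \<in> \<Lambda> - {0}" using p lat_eq_0_iff by auto
      then have "lat tau p \<notin> ball z e" using e by blast
      then have "e \<le> norm (z - lat tau p)" by (simp add: dist_norm)
      also have "\<dots> \<le> norm (w - lat tau p) + norm (z - w)"
        using norm_triangle_ineq[of "z - w" "w - lat tau p"] by (simp add: add.commute)
      also have "norm (z - w) < r" using w by (simp add: dist_norm)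
      finally have "r \<le> norm (w - lat tau p)" by (simp add: r_def)
      moreover have "c * norm (lat tau p) \<le> c * (2 * R)"
        using False c by (intro mult_left_mono) auto
      ultimately show ?thesis using cR by linarith
    qed
  qed
qed

text \<open>The correction terms cancel the leading behaviour of the summands in the lattice vector,
  leaving terms of order |l|^-3. These are majorised uniformly near \<open>z\<close>, so termwise
  differentiation applies twice.\<close>

lemma
  assumes "z \<notin> \<Lambda> - {0}"
  shows zeta_reg_has_field_derivative: "(zeta_reg has_field_derivative - wp_reg z) (at z)"
    and wp_reg_has_field_derivative: "(wp_reg has_field_derivative wp_reg' z) (at z)"
    and wp_reg'_summable: "(\<lambda>p. - 2 / (z - lat tau p)^3) summable_on I\<^sub>0"
proof -
  obtain r c where r: "r > 0" and c: "c > 0"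
    and sep': "\<And>w p. w \<in> ball z r \<Longrightarrow> p \<in> I\<^sub>0 \<Longrightarrow> c * norm (lat tau p) \<le> norm (w - lat tau p)"
    using nonzero_lattice_separation[OF assms] by blast
  define R where "R = norm z + r"
  have R: "R > 0" using r by (simp add: R_def add_nonneg_pos)
  have nw: "norm w \<le> R" if "w \<in> ball z r" for w
    using that norm_triangle_ineq2[of w z] by (simp add: R_def dist_norm norm_minus_commute)
  let ?l = "\<lambda>p. lat tau p"
  have l: "?l p \<noteq> 0" "norm (?l p) \<ge> sep" if "p \<in> I\<^sub>0" for p
    using that lat_eq_0_iff norm_lat_ge by auto
  have wl: "w - ?l p \<noteq> 0" if "w \<in> ball z r" "p \<in> I\<^sub>0" for w p
  proof
    assume "w - ?l p = 0"
    then have "c * norm (?l p) \<le> 0" using sep'[OF that] by simp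
    then show False using c l[OF that(2)] by (simp add: mult_le_0_iff)
  qed
  have b1: "norm (1 / (w - ?l p) + 1 / ?l p + w / (?l p)^2) \<le> (R^2 / c) * (1 / norm (?l p)^3)"
    if w: "w \<in> ball z r" and p: "p \<in> I\<^sub>0" for w p
  proof -
    have "1 / (w - ?l p) + 1 / ?l p + w / (?l p)^2 = w^2 / ((?l p)^2 * (w - ?l p))"
      using wl[OF w p] l(1)[OF p] by (simp add: field_simps power2_eq_square)
    also have "norm \<dots> = norm w ^ 2 / (norm (?l p)^2 * norm (w - ?l p))"
      by (simp add: norm_divide norm_mult norm_power)
    also have "\<dots> \<le> R ^ 2 / (norm (?l p)^2 * (c * norm (?l p)))"
      using sep'[OF w p] nw[OF w] c l(1)[OF p] R
      by (intro frac_le power_mono mult_left_mono mult_pos_pos) auto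
    also have "\<dots> = (R^2 / c) * (1 / norm (?l p)^3)"
      by (simp add: power2_eq_square power3_eq_cube)
    finally show ?thesis .
  qed
  \<comment> \<open>The factor 2 + R/sep arises from |2l - w| \<le> 2|l| + R together with R \<le>
    |l| R/sep.\<close>
  have b2: "norm (1 / (w - ?l p)^2 - 1 / (?l p)^2) \<le> (R * (2 + R / sep) / c^2) * (1 / norm (?l p)^3)"
    if w: "w \<in> ball z r" and p: "p \<in> I\<^sub>0" for w p
  proof -
    have "1 / (w - ?l p)^2 - 1 / (?l p)^2 = w * (2 * ?l p - w) / ((?l p)^2 * (w - ?l p)^2)"
      using wl[OF w p] l(1)[OF p] by (simp add: divide_simps) (simp add: algebra_simps power2_eq_square)
    also have "norm \<dots> = norm w * norm (2 * ?l p - w) / (norm (?l p)^2 * norm (w - ?l p)^2)"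
      by (simp add: norm_divide norm_mult norm_power)
    also have "\<dots> \<le> R * (norm (?l p) * (2 + R / sep)) / (norm (?l p)^2 * (c * norm (?l p))^2)"
    proof (intro frac_le mult_mono mult_left_mono power_mono sep'[OF w p] nw[OF w])
      have "norm (2 * ?l p - w) \<le> 2 * norm (?l p) + norm w"
        using norm_triangle_ineq4[of "2 * ?l p" w] by (simp add: norm_mult)
      also have "\<dots> \<le> 2 * norm (?l p) + R" using nw[OF w] by simp
      also have "R = sep * (R / sep)" using sep_pos by simp
      also have "\<dots> \<le> norm (?l p) * (R / sep)"
        using l[OF p] R sep_pos by (intro mult_right_mono) auto
      finally show "norm (2 * ?l p - w) \<le> norm (?l p) * (2 + R / sep)"
        by (simp add: algebra_simps)
    qed (use R sep_pos c l(1)[OF p] in auto)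
    also have "\<dots> = (R * (2 + R / sep) / c^2) * (1 / norm (?l p)^3)"
    proof -
      have "norm (?l p) > 0" using l(1)[OF p] by simp
      then show ?thesis using c
        by (simp add: power2_eq_square power3_eq_cube)
    qed
    finally show ?thesis .
  qed
  have d1: "((\<lambda>w. 1 / (w - ?l p) + 1 / ?l p + w / (?l p)^2) has_field_derivative
      - (1 / (w - ?l p)^2 - 1 / (?l p)^2)) (at w)" if "w \<in> ball z r" "p \<in> I\<^sub>0" for w p
    using wl[OF that] l(1)[OF that(2)]
    by (auto intro!: derivative_eq_intros simp: power2_eq_square field_simps)
  have d2: "((\<lambda>w. 1 / (w - ?l p)^2 - 1 / (?l p)^2) has_field_derivative
      - 2 / (w - ?l p)^3) (at w)" if "w \<in> ball z r" "p \<in> I\<^sub>0" for w p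
    using DERIV_diff[OF inverse_square_has_field_derivative[OF wl[OF that]] DERIV_const] by simp
  have z: "z \<in> ball z r" using r by simp
  have m1: "(\<lambda>p. (R^2 / c) * (1 / norm (?l p)^3)) summable_on I\<^sub>0"
    and m2: "(\<lambda>p. (R * (2 + R / sep) / c^2) * (1 / norm (?l p)^3)) summable_on I\<^sub>0"
    by (intro summable_on_cmult_right summable_on_inverse_cube_lat)+
  note 1 = infsum_has_field_derivative[OF open_ball z d1 b1 m1]
  note 2 = infsum_has_field_derivative[OF open_ball z d2 b2 m2]
  show "(zeta_reg has_field_derivative - wp_reg z) (at z)"
    using 1(2) unfolding zeta_reg_def[abs_def] wp_reg_def by (simp only: infsum_uminus)
  show "(wp_reg has_field_derivative wp_reg' z) (at z)"
    using 2(2) unfolding wp_reg'_def wp_reg_def[abs_def] by simp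
  show "(\<lambda>p. - 2 / (z - lat tau p)^3) summable_on I\<^sub>0"
    by (rule 2(1))
qed

lemma zeta_reg_holomorphic: "zeta_reg holomorphic_on - (\<Lambda> - {0})"
  and wp_reg_holomorphic: "wp_reg holomorphic_on - (\<Lambda> - {0})"
  using zeta_reg_has_field_derivative wp_reg_has_field_derivative open_compl_nonzero_lattice
  by (simp_all add: holomorphic_on_open) blast+

lemma wp_reg'_holomorphic: "wp_reg' holomorphic_on - (\<Lambda> - {0})"
proof -
  have "deriv wp_reg holomorphic_on - (\<Lambda> - {0})"
    by (intro holomorphic_deriv wp_reg_holomorphic open_compl_nonzero_lattice)
  moreover have "deriv wp_reg z = wp_reg' z" if "z \<in> - (\<Lambda> - {0})" for z
    using wp_reg_has_field_derivative that by (intro DERIV_imp_deriv) auto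
  ultimately show ?thesis by (rule holomorphic_transform)
qed

lemma zeta_reg_0: "zeta_reg 0 = 0" and wp_reg_0: "wp_reg 0 = 0"
  unfolding zeta_reg_def wp_reg_def by (auto intro!: infsum_0)

lemma wzeta_has_field_derivative:
  assumes "z \<notin> \<Lambda>"
  shows "(wzeta tau has_field_derivative - wp tau z) (at z)"
proof -
  have z: "z \<noteq> 0" using assms by (metis zero_in_lattice)
  have "((\<lambda>z. 1 / z + zeta_reg z) has_field_derivative (- 1 / z^2 + - wp_reg z)) (at z)"
    using assms z
    by (intro DERIV_add zeta_reg_has_field_derivative)
       (auto intro!: derivative_eq_intros simp: power2_eq_square)
  then show ?thesis unfolding wzeta_eq[abs_def] wp_eq by simp
qed

lemma wp_has_field_derivative':
  assumes "z \<notin> \<Lambda>"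
  shows "(wp tau has_field_derivative - 2 / z^3 + wp_reg' z) (at z)"
proof -
  have z: "z \<noteq> 0" using assms by (metis zero_in_lattice)
  have "((\<lambda>z. 1 / z^2 + wp_reg z) has_field_derivative (- 2 / z^3 + wp_reg' z)) (at z)"
    using assms z
    by (intro DERIV_add wp_reg_has_field_derivative)
       (use inverse_square_has_field_derivative[of z 0] in auto)
  then show ?thesis unfolding wp_eq[abs_def] .
qed

lemma wp'_eq: "z \<notin> \<Lambda> \<Longrightarrow> wp' tau z = - 2 / z^3 + wp_reg' z"
  unfolding wp'_def by (rule DERIV_imp_deriv[OF wp_has_field_derivative'])

lemma wp_has_field_derivative: "z \<notin> \<Lambda> \<Longrightarrow> (wp tau has_field_derivative wp' tau z) (at z)"
  using wp_has_field_derivative' wp'_eq by simp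

lemma wzeta_holomorphic: "wzeta tau holomorphic_on - \<Lambda>"
  and wp_holomorphic: "wp tau holomorphic_on - \<Lambda>"
  using wzeta_has_field_derivative wp_has_field_derivative open_compl_lattice
  by (simp_all add: holomorphic_on_open) blast+

lemma wp'_holomorphic: "wp' tau holomorphic_on - \<Lambda>"
  unfolding wp'_def[abs_def] by (intro holomorphic_deriv wp_holomorphic open_compl_lattice)

text \<open>This series converges absolutely over the whole lattice without correction terms, so a
  lattice translation merely reindexes it. Periodicity of \<open>wp'\<close> starts here, and that
  of \<open>wp\<close> is deduced by integration.\<close>

lemma wp'_has_sum: 
  assumes "z \<notin> \<Lambda>"
  shows "((\<lambda>p. - 2 / (z - lat tau p)^3) has_sum wp' tau z) UNIV"
proof -
  have "((\<lambda>p. - 2 / (z - lat tau p)^3) has_sum wp_reg' z) I\<^sub>0"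
    unfolding wp_reg'_def using assms by (intro has_sum_infsum wp_reg'_summable) auto
  then have "((\<lambda>p. - 2 / (z - lat tau p)^3) has_sum (- 2 / (z - lat tau (0,0))^3 + wp_reg' z)) (insert (0,0) I\<^sub>0)"
    by (intro has_sum_insert) auto
  moreover have "insert (0,0) I\<^sub>0 = UNIV" by auto
  ultimately show ?thesis by (simp add: wp'_eq[OF assms] lat_eq)
qed

lemma wp'_periodic:
  assumes "z \<notin> \<Lambda>" "w \<in> \<Lambda>"
  shows "wp' tau (z + w) = wp' tau z"
proof -
  obtain q where q: "w = lat tau q" using assms by auto
  have "((\<lambda>p. - 2 / (z + w - lat tau p)^3) has_sum wp' tau (z + w)) UNIV"
    using assms lattice_add_iff by (intro wp'_has_sum) auto
  moreover have "((\<lambda>p. - 2 / (z - lat tau p)^3) has_sum wp' tau z) UNIV \<longleftrightarrow>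
      ((\<lambda>p. - 2 / (z + w - lat tau p)^3) has_sum wp' tau z) UNIV"
    by (rule has_sum_reindex_bij_witness
        [where i = "\<lambda>p. (fst p - fst q, snd p - snd q)" and j = "\<lambda>p. (fst p + fst q, snd p + snd q)"])
       (auto simp: q lat_def algebra_simps)
  ultimately show ?thesis
    using wp'_has_sum[OF assms(1)] has_sum_unique by blast
qed

lemma infsum_uminus_lat: "infsum (\<lambda>p. f (lat tau p)) I\<^sub>0 = infsum (\<lambda>p. f (- lat tau p)) I\<^sub>0"
  by (rule infsum_reindex_bij_witness
        [where i = "\<lambda>p. (- fst p, - snd p)" and j = "\<lambda>p. (- fst p, - snd p)"])
     (auto simp: lat_def algebra_simps)

lemma wp_reg_even: "wp_reg (- z) = wp_reg z"
  unfolding wp_reg_def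
  by (subst infsum_uminus_lat) (simp add: power2_commute[of z] add.commute)

lemma zeta_reg_odd: "zeta_reg (- z) = - zeta_reg z"
proof -
  have "zeta_reg (- z) = infsum (\<lambda>p. 1 / (- z + lat tau p) + 1 / (- lat tau p) + (- z) / (- lat tau p)^2) I\<^sub>0"
    unfolding zeta_reg_def by (subst infsum_uminus_lat) simp
  also have "\<dots> = infsum (\<lambda>p. - (1 / (z - lat tau p) + 1 / lat tau p + z / (lat tau p)^2)) I\<^sub>0"
  proof (intro infsum_cong)
    fix p
    have "1 / (- z + lat tau p) = - (1 / (z - lat tau p))"
      by (metis add.commute divide_minus_right minus_diff_eq uminus_add_conv_diff)
    then show "1 / (- z + lat tau p) + 1 / (- lat tau p) + (- z) / (- lat tau p)^2 =
        - (1 / (z - lat tau p) + 1 / lat tau p + z / (lat tau p)^2)" by simp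
  qed
  finally show ?thesis unfolding infsum_uminus zeta_reg_def .
qed

lemma wp_even: "wp tau (- z) = wp tau z"
  by (simp add: wp_eq wp_reg_even)

lemma wzeta_odd: "wzeta tau (- z) = - wzeta tau z"
  by (simp add: wzeta_eq zeta_reg_odd)

lemma wp'_odd: 
  assumes "z \<notin> \<Lambda>"
  shows "wp' tau (- z) = - wp' tau z"
proof -
  have "((\<lambda>z. wp tau (- z)) has_field_derivative wp' tau (- z) * - 1) (at z)"
    using assms by (intro DERIV_chain2[OF wp_has_field_derivative]) (auto intro!: derivative_eq_intros)
  then have "(wp tau has_field_derivative - wp' tau (- z)) (at z)" by (simp add: wp_even)
  then have "- wp' tau (- z) = wp' tau z"
    using wp_has_field_derivative[OF assms] DERIV_unique by blast
  then show ?thesis by (metis minus_minus)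
qed

lemma constant_on_compl_lattice:
  assumes "\<And>z. z \<notin> \<Lambda> \<Longrightarrow> (f has_field_derivative 0) (at z)" "z \<notin> \<Lambda>" "w \<notin> \<Lambda>"
  shows "f z = f w"
proof -
  have "f constant_on - \<Lambda>"
    using has_field_derivative_0_imp_constant_on[of "- \<Lambda>" f] assms(1)
      connected_compl_lattice open_compl_lattice by auto
  then show ?thesis using assms by (auto simp: constant_on_def)
qed

lemma derivative_shift_lattice:
  assumes "\<And>z. z \<notin> \<Lambda> \<Longrightarrow> (f has_field_derivative f' z) (at z)" "z \<notin> \<Lambda>" "w \<in> \<Lambda>"
  shows "((\<lambda>z. f (z + w)) has_field_derivative f' (z + w)) (at z)"
  using assms(1)[of "z + w"] assms(2,3) lattice_add_iff[of w z] by (simp add: DERIV_shift)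

text \<open>The difference has derivative 0, hence is constant, and at -w/2 it vanishes because
  \<open>wp\<close> is even. The point -w/2 must not be a pole, so the argument is made for the
  generators 1 and \<open>tau\<close> and then iterated.\<close>

lemma wp_periodic_aux:
  assumes "z \<notin> \<Lambda>" "w \<in> \<Lambda>" "w / 2 \<notin> \<Lambda>"
  shows "wp tau (z + w) = wp tau z"
proof -
  have "wp tau (z + w) - wp tau z = wp tau (- (w/2) + w) - wp tau (- (w/2))"
  proof (rule constant_on_compl_lattice[of "\<lambda>z. wp tau (z + w) - wp tau z"])
    fix z assume z: "z \<notin> \<Lambda>"
    show "((\<lambda>z. wp tau (z + w) - wp tau z) has_field_derivative 0) (at z)"
      using DERIV_diff[OF derivative_shift_lattice[OF wp_has_field_derivative z assms(2)] 
          wp_has_field_derivative[OF z]] wp'_periodic[OF z assms(2)]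
      by simp
  qed (use assms in auto)
  also have "\<dots> = 0" by (simp add: wp_even)
  finally show ?thesis by simp
qed

lemma lattice_induct_periodic:
  assumes 1: "\<And>z. z \<notin> \<Lambda> \<Longrightarrow> f (z + 1) = f z + k1"
    and tau: "\<And>z. z \<notin> \<Lambda> \<Longrightarrow> f (z + tau) = f z + k2"
    and z: "z \<notin> \<Lambda>"
  shows "f (z + lat tau (m, n)) = f z + of_int m * k1 + of_int n * (k2::complex)"
proof -
  have inv: "z + w \<in> - \<Lambda>" "z - w \<in> - \<Lambda>" if "z \<in> - \<Lambda>" "w \<in> \<Lambda>" for z w
    using that lattice_add_iff[of w z] lattice_add_iff[of "- w" z] by auto
  have "f (z + of_int m * 1) = f z + of_int m * k1"
    by (rule int_induct_shift[of "- \<Lambda>"]) (use 1 z inv in auto)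
  moreover have "f (z + of_int m * 1 + of_int n * tau) = f (z + of_int m * 1) + of_int n * k2"
    by (rule int_induct_shift[of "- \<Lambda>"])
       (use tau inv lattice_add_iff[OF lattice_int_mult[OF one_in_lattice], of z m] z in auto)
  ultimately show ?thesis by (simp add: lat_eq algebra_simps)
qed

lemma wp_periodic:
  assumes "z \<notin> \<Lambda>" "w \<in> \<Lambda>"
  shows "wp tau (z + w) = wp tau z"
proof -
  obtain m n where w: "w = lat tau (m, n)" using assms by auto
  show ?thesis
    using lattice_induct_periodic[of "wp tau" 0 0 z m n] wp_periodic_aux half_not_in_lattice assms
    by (simp add: w)
qed

text \<open>The constant is again evaluated at -w/2, which yields exactly the expressions that
  define \<open>eta1\<close> and \<open>eta2\<close>.\<close>

lemma wzeta_shift_aux: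
  assumes "z \<notin> \<Lambda>" "w \<in> \<Lambda>" "w / 2 \<notin> \<Lambda>"
  shows "wzeta tau (z + w) = wzeta tau z + (wzeta tau (w/2) - wzeta tau (- w/2))"
proof -
  have "wzeta tau (z + w) - wzeta tau z = wzeta tau (- (w/2) + w) - wzeta tau (- (w/2))"
  proof (rule constant_on_compl_lattice[of "\<lambda>z. wzeta tau (z + w) - wzeta tau z"])
    fix z assume z: "z \<notin> \<Lambda>"
    show "((\<lambda>z. wzeta tau (z + w) - wzeta tau z) has_field_derivative 0) (at z)"
      using DERIV_diff[OF derivative_shift_lattice[OF wzeta_has_field_derivative z assms(2)] 
          wzeta_has_field_derivative[OF z]] wp_periodic[OF z assms(2)]
      by simp
  qed (use assms in auto)
  then show ?thesis by (simp add: algebra_simps)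
qed

lemma wzeta_shift_1: "z \<notin> \<Lambda> \<Longrightarrow> wzeta tau (z + 1) = wzeta tau z + eta1 tau"
  and wzeta_shift_tau: "z \<notin> \<Lambda> \<Longrightarrow> wzeta tau (z + tau) = wzeta tau z + eta2 tau"
  using wzeta_shift_aux[of z 1] wzeta_shift_aux[of z tau] half_not_in_lattice
  by (simp_all add: eta1_def eta2_def)

lemma wzeta_shift:
  "z \<notin> \<Lambda> \<Longrightarrow> wzeta tau (z + lat tau (m, n)) = wzeta tau z + of_int m * eta1 tau + of_int n * eta2 tau"
  by (rule lattice_induct_periodic[OF wzeta_shift_1 wzeta_shift_tau])

lemma eventually_not_in_lattice: "eventually (\<lambda>z. z \<notin> \<Lambda>) (at w)"
proof (cases "w \<in> \<Lambda>")
  case True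
  then show ?thesis
    unfolding eventually_at using lattice_dist sep_pos by blast
next
  case False
  then have "eventually (\<lambda>z. z \<in> - \<Lambda>) (at w)"
    using open_compl_lattice by (intro eventually_at_in_open') auto
  then show ?thesis by simp
qed

section \<open>Liouville's theorem for quasi-periodic functions\<close>

lemma doubly_periodic_bounded:
  assumes cont: "continuous_on UNIV h" and per: "\<And>z. h (z + 1) = h z" "\<And>z. h (z + tau) = (h z :: complex)"
  shows "bounded (range h)"
proof -
  have shift: "h (z + lat tau (m, n)) = h z" for z m n
  proof -
    have "h (z + of_int m * 1) = h z + of_int m * 0"
      by (rule int_induct_shift[of UNIV]) (use per in auto)
    moreover have "h (z + of_int m * 1 + of_int n * tau) = h (z + of_int m * 1) + of_int n * 0"
      by (rule int_induct_shift[of UNIV]) (use per in auto)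
    ultimately show ?thesis by (simp add: lat_eq algebra_simps)
  qed
  let ?K = "(\<lambda>(x, y). of_real x + of_real y * tau) ` ({0..1} \<times> {0..1})"
  have "compact ?K"
    by (intro compact_continuous_image compact_Times)
       (auto simp: case_prod_unfold intro!: continuous_intros)
  then have "compact (h ` ?K)"
    by (rule compact_continuous_image[OF continuous_on_subset[OF cont subset_UNIV]])
  moreover have "range h \<subseteq> h ` ?K"
  proof (rule image_subsetI)
    fix z
    obtain x y where z: "z = of_real x + of_real y * tau" by (rule exists_combination)
    have "z = of_real (frac x) + of_real (frac y) * tau + lat tau (\<lfloor>x\<rfloor>, \<lfloor>y\<rfloor>)"
      by (simp add: z lat_eq frac_def algebra_simps)
    then have "h z = h (of_real (frac x) + of_real (frac y) * tau)"
      using shift by simp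
    moreover have "of_real (frac x) + of_real (frac y) * tau \<in> ?K"
      by (rule image_eqI[where x = "(frac x, frac y)"]) (auto simp: less_imp_le[OF frac_lt_1])
    ultimately show "h z \<in> h ` ?K" by (simp add: rev_image_eqI)
  qed
  ultimately show ?thesis
    by (meson bounded_subset compact_imp_bounded)
qed

text \<open>Quasi-periodicity carries the finite limit at 0 to every lattice point, so
  \<open>f\<close> extends to an entire function. Its derivative is doubly periodic, hence bounded
  and constant. The slope is \<open>k1\<close>, and the shift by \<open>tau\<close> then forces the
  second conclusion, from which Legendre's relation and the value of one integration constant are
  obtained.\<close>

lemma quasi_periodic_linear:
  assumes hol: "f holomorphic_on - \<Lambda>"
    and 1: "\<And>z. z \<notin> \<Lambda> \<Longrightarrow> f (z + 1) = f z + k1"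
    and tau: "\<And>z. z \<notin> \<Lambda> \<Longrightarrow> f (z + tau) = f z + k2"
    and lim: "(f \<longlongrightarrow> c) (at 0)"
  shows "z \<notin> \<Lambda> \<Longrightarrow> f z = k1 * z + c" and "k2 = k1 * tau"
proof -
  define g where "g = (\<lambda>z. if z \<in> \<Lambda> then Lim (at z) f else f z)"
  have lim': "(f \<longlongrightarrow> c + of_int m * k1 + of_int n * k2) (at (lat tau (m, n)))" for m n
  proof -
    let ?w = "lat tau (m, n)"
    have "((\<lambda>z. f (z - ?w)) \<longlongrightarrow> c) (at ?w)"
      using LIM_offset[OF lim, of "- ?w"] by simp
    then have "((\<lambda>z. f (z - ?w) + of_int m * k1 + of_int n * k2) \<longlongrightarrow> c + of_int m * k1 + of_int n * k2) (at ?w)"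
      by (intro tendsto_intros)
    then show ?thesis
    proof (rule Lim_transform_eventually)
      show "\<forall>\<^sub>F z in at ?w. f (z - ?w) + of_int m * k1 + of_int n * k2 = f z"
        using eventually_not_in_lattice
      proof eventually_elim
        case (elim z)
        then have "z - ?w \<notin> \<Lambda>" using lattice_add_iff[of "- ?w" z] by simp
        from lattice_induct_periodic[OF 1 tau this, of m n] show ?case by simp
      qed
    qed
  qed
  have g_lat: "g (lat tau (m, n)) = c + of_int m * k1 + of_int n * k2" for m n
    using tendsto_Lim[OF _ lim'] by (simp add: g_def)
  have "g holomorphic_on ball z sep" if z: "z \<in> \<Lambda>" for z
  proof (rule no_isolated_singularity'[where K = "{z}"])
    obtain m n where mn: "z = lat tau (m, n)" using z by auto
    fix w assume "w \<in> {z}"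
    then have w: "w = z" by simp
    have "(g \<longlongrightarrow> g z) (at z)"
      unfolding mn g_lat using lim'[of m n]
      by (rule Lim_transform_eventually)
         (use eventually_not_in_lattice[of "lat tau (m, n)"] in eventually_elim, simp add: g_def)
    then show "(g \<longlongrightarrow> g w) (at w within ball z sep)"
      unfolding w by (rule tendsto_within_subset) auto
  next
    have "f holomorphic_on ball z sep - {z}"
    proof (rule holomorphic_on_subset[OF hol], rule subsetI)
      fix w assume w: "w \<in> ball z sep - {z}"
      then show "w \<in> - \<Lambda>" using lattice_dist[OF z, of w] by auto
    qed
    moreover have "f w = g w" if "w \<in> ball z sep - {z}" for w
      using lattice_dist[OF z, of w] that by (auto simp: g_def simp del: image_iff)
    ultimately show "g holomorphic_on ball z sep - {z}"
      by (rule holomorphic_transform)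
  qed auto
  then have A: "g field_differentiable at z" if "z \<in> \<Lambda>" for z
    using that sep_pos by (meson centre_in_ball holomorphic_on_imp_differentiable_at open_ball)
  have "g holomorphic_on - \<Lambda>"
    by (rule holomorphic_transform[OF hol]) (simp add: g_def)
  then have "g field_differentiable at z" if "z \<notin> \<Lambda>" for z
    using that open_compl_lattice by (meson ComplI holomorphic_on_imp_differentiable_at)
  with A have g_hol: "g holomorphic_on UNIV"
    unfolding holomorphic_on_def by blast
  have g1: "g (z + 1) = g z + k1" for z
  proof (cases "z \<in> \<Lambda>")
    case True
    then obtain m n where z: "z = lat tau (m, n)" by auto
    have "z + 1 = lat tau (m + 1, n)" by (simp add: z lat_eq)
    then show ?thesis using g_lat[of "m + 1" n] g_lat[of m n] by (simp add: z algebra_simps)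
  next
    case False
    then show ?thesis using 1 lattice_add_iff[of 1 z] by (simp add: g_def)
  qed
  have gt: "g (z + tau) = g z + k2" for z
  proof (cases "z \<in> \<Lambda>")
    case True
    then obtain m n where z: "z = lat tau (m, n)" by auto
    have "z + tau = lat tau (m, n + 1)" by (simp add: z lat_eq algebra_simps)
    then show ?thesis using g_lat[of m "n + 1"] g_lat[of m n] by (simp add: z algebra_simps)
  next
    case False
    then show ?thesis using tau lattice_add_iff[of tau z] by (simp add: g_def)
  qed
  have dg: "(g has_field_derivative deriv g z) (at z)" for z
    using g_hol by (intro holomorphic_derivI[of _ UNIV]) auto
  have per: "deriv g (z + w) = deriv g z" if "\<And>z. g (z + w) = g z + k" for z w k
  proof -
    have "((\<lambda>z. g (z + w)) has_field_derivative deriv g (z + w)) (at z)"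
      using dg[of "z + w"] by (simp add: DERIV_shift)
    moreover have "((\<lambda>z. g (z + w)) has_field_derivative deriv g z + 0) (at z)"
      unfolding that by (intro DERIV_add dg DERIV_const)
    ultimately show ?thesis using DERIV_unique by fastforce
  qed
  have hol': "deriv g holomorphic_on UNIV" using g_hol by (intro holomorphic_deriv) auto
  then have "bounded (range (deriv g))"
    using per[OF g1] per[OF gt] by (intro doubly_periodic_bounded holomorphic_on_imp_continuous_on) auto
  then obtain k where k: "\<And>z. deriv g z = k"
    using Liouville_theorem[OF hol'] by (auto simp: constant_on_def)
  have "\<exists>c. \<forall>z\<in>UNIV. g z - k * z = c"
  proof (rule has_field_derivative_zero_constant)
    show "((\<lambda>z. g z - k * z) has_field_derivative 0) (at z within UNIV)" for z
      using dg[of z] k by (auto intro!: derivative_eq_intros)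
  qed simp
  then obtain k0 where "\<And>z. g z - k * z = k0" by auto
  then have k0: "g z = k * z + k0" for z by (metis add.commute diff_add_cancel)
  have "k0 = c" using g_lat[of 0 0] k0[of 0] by (simp add: lat_eq)
  moreover have "k1 = k" using g1[of 0] by (simp add: k0)
  moreover have "k2 = k * tau" using gt[of 0] by (simp add: k0)
  ultimately show "k2 = k1 * tau" "z \<notin> \<Lambda> \<Longrightarrow> f z = k1 * z + c"
    using k0[of z] by (auto simp: g_def)
qed

end

section \<open>Lambert series\<close>

text \<open>With y the (j+1)-st root of q, the term equals (n y^n)^j y^n, a bounded factor times a
  convergent geometric series.\<close>

lemma summable_power_times_geometric:
  fixes q :: real
  assumes "0 < q" "q < 1"
  shows "summable (\<lambda>n. real n ^ j * q ^ n)"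
proof -
  define y where "y = root (Suc j) q"
  have y: "0 < y" "y < 1" "y ^ Suc j = q"
    using assms by (auto simp: y_def simp del: power_Suc)
  have "(\<lambda>n. of_nat n * y ^ n) \<longlonglongrightarrow> 0"
    using y by (intro powser_times_n_limit_0) auto
  then have "Bseq (\<lambda>n. of_nat n * y ^ n)"
    by (rule convergent_imp_Bseq[OF convergentI])
  then obtain B where B: "B > 0" "\<And>n. norm (of_nat n * y ^ n) \<le> B"
    unfolding Bseq_def by blast
  show ?thesis
  proof (rule summable_comparison_test)
    show "summable (\<lambda>n. B ^ j * y ^ n)"
      using y by (intro summable_mult summable_geometric) auto
    show "\<exists>N. \<forall>n\<ge>N. norm (real n ^ j * q ^ n) \<le> B ^ j * y ^ n"
    proof (intro exI allI impI)
      fix n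
      have "real n ^ j * q ^ n = (real n * y ^ n) ^ j * y ^ n"
        by (simp add: y(3)[symmetric] power_mult_distrib power_add power_mult[symmetric] algebra_simps)
      also have "norm \<dots> \<le> B ^ j * y ^ n"
        using B(2)[of n] y by (auto simp: abs_mult power_abs intro!: mult_right_mono power_mono)
      finally show "norm (real n ^ j * q ^ n) \<le> B ^ j * y ^ n" .
    qed
  qed
qed

text \<open>With E(w) = (exp w - 1)/w, continued by E(0) = 1, the expression is the difference
  quotient at 0 of 1 - exp w / E(w). Hence the kernel has a simple pole with residue -1.\<close>

lemma lambert_kernel_at_0:
  obtains c :: complex where "((\<lambda>w. exp w / (1 - exp w) + 1 / w) \<longlongrightarrow> c) (at 0)"
proof -
  define E where "E = (\<lambda>w::complex. if w = 0 then 1 else (exp w - 1) / w)"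
  have "E holomorphic_on UNIV"
    unfolding E_def by (rule removable_singularity) (auto intro!: holomorphic_intros lim_exp_minus_1)
  then have E: "E field_differentiable at 0"
    by (simp add: holomorphic_on_def)
  have E0: "E 0 = 1" by (simp add: E_def)
  have "(\<lambda>w. 1 - exp w / E w) field_differentiable at 0"
    using E E0 by (intro derivative_intros field_differentiable_divide)
      (auto intro: field_differentiable_within_exp)
  then obtain c where "((\<lambda>w. 1 - exp w / E w) has_field_derivative c) (at 0)"
    by (auto simp: field_differentiable_def)
  then have "((\<lambda>w. (1 - exp w / E w - (1 - exp 0 / E 0)) / (w - 0)) \<longlongrightarrow> c) (at 0)"
    by (simp only: has_field_derivative_iff)
  moreover have "\<forall>\<^sub>F w in at 0. (1 - exp w / E w - (1 - exp 0 / E 0)) / (w - 0) = exp w / (1 - exp w) + 1 / w"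
    using eventually_neq_at_within[of 0 0 UNIV] 
  proof eventually_elim
    case (elim w)
    show ?case
    \<comment> \<open>If exp w = 1, then both sides reduce to 1/w, because a quotient by 0 is
      0.\<close>
    proof (cases "exp w = 1")
      case True
      then show ?thesis using elim by (simp add: E_def)
    next
      case False
      then have "exp w - 1 \<noteq> 0" "1 - exp w \<noteq> 0" by auto
      then show ?thesis using elim by (simp add: E_def) (simp add: divide_simps, algebra)
    qed
  qed
  ultimately have "((\<lambda>w. exp w / (1 - exp w) + 1 / w) \<longlongrightarrow> c) (at 0)"
    by (rule Lim_transform_eventually)
  then show ?thesis by (rule that)
qed

section \<open>Lambert sums: convergence, translation and parity\<close>

context upper_half_plane
begin

definition nome_pow :: "nat \<Rightarrow> complex \<Rightarrow> complex" where
  "nome_pow k a = exp (2 * of_real pi * \<i> * (a + of_nat k * tau))"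

definition lambert :: "nat \<Rightarrow> complex \<Rightarrow> complex" where
  "lambert k a = nome_pow k a / (1 - nome_pow k a)"

text \<open>The index starts at 1. The term \<open>lambert 0\<close>, which has a pole at 0, is kept
  outside, so \<open>lambert_sum\<close> is holomorphic at the origin.\<close>

definition lambert_sum :: "nat \<Rightarrow> complex \<Rightarrow> complex" where
  "lambert_sum j a = (\<Sum>k. of_nat (Suc k) ^ j * lambert (Suc k) a)"

lemma nome_pow_eq_1D:
  assumes "nome_pow k a = 1"
  shows "\<exists>m. a = lat tau (m, - int k)"
proof -
  let ?w = "a + of_nat k * tau"
  obtain n :: int where n: "- 2 * pi * Im ?w = 0" "2 * pi * Re ?w = of_int (2 * n) * pi"
    using assms unfolding nome_pow_def exp_eq_1 by (auto simp: algebra_simps)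
  then have "?w = of_int n" by (auto simp: complex_eq_iff)
  then have "a = lat tau (n, - int k)" by (simp add: lat_eq eq_diff_eq)
  then show ?thesis by blast
qed

lemma nome_pow_neq_1: "a \<notin> \<Lambda> - {0} \<Longrightarrow> nome_pow (Suc k) a \<noteq> 1"
proof
  assume a: "a \<notin> \<Lambda> - {0}" and eq: "nome_pow (Suc k) a = 1"
  obtain m where m: "a = lat tau (m, - int (Suc k))" using nome_pow_eq_1D[OF eq] by blast
  then have "a \<noteq> 0" by (simp add: lat_eq_0_iff)
  with a m show False by blast
qed

lemma nome_pow_0_neq_1: "a \<notin> \<Lambda> \<Longrightarrow> nome_pow 0 a \<noteq> 1"
  using nome_pow_eq_1D[of 0 a] by blast

lemma nome_pow_shift: "nome_pow k (a + tau) = nome_pow (Suc k) a"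
  by (simp add: nome_pow_def algebra_simps)

lemma nome_pow_period: "nome_pow k (a + 1) = nome_pow k a"
  by (simp add: nome_pow_def algebra_simps exp_add)

lemma lambert_shift: "lambert k (a + tau) = lambert (Suc k) a"
  by (simp add: lambert_def nome_pow_shift)

lemma lambert_period: "lambert k (a + 1) = lambert k a"
  by (simp add: lambert_def nome_pow_period)

lemma lambert_0_uminus: "a \<notin> \<Lambda> \<Longrightarrow> lambert 0 (- a) = - 1 - lambert 0 a"
proof -
  assume a: "a \<notin> \<Lambda>"
  have "nome_pow 0 (- a) = 1 / nome_pow 0 a"
    by (simp add: nome_pow_def exp_minus inverse_eq_divide)
  moreover have "nome_pow 0 a \<noteq> 1" "nome_pow 0 a \<noteq> 0"
    using nome_pow_0_neq_1[OF a] by (auto simp: nome_pow_def)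
  moreover have "(1 / u) / (1 - 1 / u) = - 1 - u / (1 - u)" if "u \<noteq> 1" "u \<noteq> 0" for u :: complex
  proof -
    have "u - 1 \<noteq> 0" "1 - u \<noteq> 0" using that by auto
    then show ?thesis using that by (simp add: divide_simps)
  qed
  ultimately show ?thesis by (simp add: lambert_def)
qed

lemma norm_nome_pow: "norm (nome_pow k a) = exp (- 2 * pi * Im a) * exp (- 2 * pi * Im tau) ^ k"
  by (simp add: nome_pow_def norm_exp_eq_Re exp_of_nat_mult[symmetric] exp_add[symmetric] algebra_simps)

definition maj :: "real \<Rightarrow> nat \<Rightarrow> nat \<Rightarrow> real" where
  "maj R j k = 2 * exp (2 * pi * R) * (real (Suc k) ^ j * exp (- 2 * pi * Im tau) ^ Suc k)"

lemma summable_maj: "summable (maj R j)"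
proof -
  have "summable (\<lambda>n. real n ^ j * exp (- 2 * pi * Im tau) ^ n)"
    using Im_tau by (intro summable_power_times_geometric) auto
  then have "summable (\<lambda>k. real (Suc k) ^ j * exp (- 2 * pi * Im tau) ^ Suc k)"
    by (subst summable_Suc_iff)
  then show ?thesis unfolding maj_def[abs_def] by (rule summable_mult)
qed

text \<open>For large k, |xi_k| < 1/2 uniformly on |a| \<le> R, so |1 - xi_k| \<ge> 1/2; this is the
  factor 2 in \<open>maj\<close>. Finitely many earlier terms may have poles in the disc, hence the
  estimate is only eventual.\<close>

lemma eventually_lambert_le_maj:
  "\<forall>\<^sub>F k in sequentially. \<forall>a. norm a \<le> R \<longrightarrow> norm (of_nat (Suc k) ^ j * lambert (Suc k) a) \<le> maj R j k"
proof -
  let ?Q = "exp (- 2 * pi * Im tau)"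
  have "(\<lambda>k. ?Q ^ Suc k) \<longlonglongrightarrow> 0"
    using Im_tau by (intro LIMSEQ_Suc LIMSEQ_realpow_zero) auto
  then have "(\<lambda>k. exp (2 * pi * R) * ?Q ^ Suc k) \<longlonglongrightarrow> exp (2 * pi * R) * 0"
    by (intro tendsto_intros)
  then have "\<forall>\<^sub>F k in sequentially. exp (2 * pi * R) * ?Q ^ Suc k < 1/2"
    by (intro order_tendstoD(2)[of _ "exp (2 * pi * R) * 0"]) auto
  then show ?thesis
  proof eventually_elim
    case (elim k)
    show ?case
    proof (intro allI impI)
      fix a :: complex assume a: "norm a \<le> R"
      have "- Im a \<le> R" using a abs_Im_le_cmod[of a] by linarith
      then have "norm (nome_pow (Suc k) a) \<le> exp (2 * pi * R) * ?Q ^ Suc k"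
        unfolding norm_nome_pow using mult_left_mono[of "- Im a" R "2 * pi"]
        by (intro mult_right_mono) auto
      note le = this
      let ?e = "nome_pow (Suc k) a"
      have "1/2 \<le> 1 - norm ?e" using le elim by linarith
      also have "\<dots> \<le> norm (1 - ?e)" using norm_triangle_ineq2[of 1 ?e] by simp
      finally have "norm ?e / norm (1 - ?e) \<le> norm ?e / (1/2)"
        by (intro divide_left_mono mult_pos_pos) auto
      then have "norm (lambert (Suc k) a) \<le> 2 * (exp (2 * pi * R) * ?Q ^ Suc k)"
        using le by (simp add: lambert_def norm_divide)
      then have "real (Suc k) ^ j * norm (lambert (Suc k) a) \<le> real (Suc k) ^ j * (2 * (exp (2 * pi * R) * ?Q ^ Suc k))"
        by (intro mult_left_mono) auto
      then show "norm (of_nat (Suc k) ^ j * lambert (Suc k) a) \<le> maj R j k"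
        by (simp add: maj_def norm_mult norm_power algebra_simps del: of_nat_Suc power_Suc)
    qed
  qed
qed

lemma lambert_sum_summable: "summable (\<lambda>k. of_nat (Suc k) ^ j * lambert (Suc k) a)"
proof (rule summable_comparison_test_ev[OF _ summable_maj])
  show "\<forall>\<^sub>F k in sequentially. norm (of_nat (Suc k) ^ j * lambert (Suc k) a) \<le> maj (norm a) j k"
    using eventually_lambert_le_maj[of "norm a" j] by (rule eventually_mono) blast
qed

lemma lambert_sum_holomorphic: "lambert_sum j holomorphic_on - (\<Lambda> - {0})"
proof (rule holomorphic_uniform_sequence[OF open_compl_nonzero_lattice])
  fix n
  show "(\<lambda>a. \<Sum>k<n. of_nat (Suc k) ^ j * lambert (Suc k) a) holomorphic_on - (\<Lambda> - {0})"
    unfolding lambert_def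
    by (intro holomorphic_intros) (use nome_pow_neq_1 in \<open>auto simp: nome_pow_def[abs_def] intro!: holomorphic_intros\<close>)
next
  fix x assume "x \<in> - (\<Lambda> - {0})"
  then obtain d where d: "d > 0" "cball x d \<subseteq> - (\<Lambda> - {0})"
    using open_compl_nonzero_lattice open_contains_cball by blast
  have "uniform_limit (cball x d) (\<lambda>n a. \<Sum>k<n. of_nat (Suc k) ^ j * lambert (Suc k) a) (lambert_sum j) sequentially"
    unfolding lambert_sum_def[abs_def]
  proof (rule Weierstrass_m_test_ev[OF _ summable_maj])
    show "\<forall>\<^sub>F k in sequentially. \<forall>a\<in>cball x d. norm (of_nat (Suc k) ^ j * lambert (Suc k) a) \<le> maj (norm x + d) j k"
      using eventually_lambert_le_maj[of "norm x + d" j]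
    proof eventually_elim
      case (elim k)
      show ?case
      proof
        fix a assume "a \<in> cball x d"
        then have "norm a \<le> norm x + d"
          using norm_triangle_ineq2[of a x] by (simp add: dist_norm norm_minus_commute)
        with elim show "norm (of_nat (Suc k) ^ j * lambert (Suc k) a) \<le> maj (norm x + d) j k" by blast
      qed
    qed
  qed
  with d show "\<exists>d>0. cball x d \<subseteq> - (\<Lambda> - {0}) \<and>
      uniform_limit (cball x d) (\<lambda>n a. \<Sum>k<n. of_nat (Suc k) ^ j * lambert (Suc k) a) (lambert_sum j) sequentially"
    by blast
qed

lemma lambert_sum_uminus_holomorphic: "(\<lambda>a. lambert_sum j (- a)) holomorphic_on - (\<Lambda> - {0})"
proof -
  have "uminus ` (- (\<Lambda> - {0})) \<subseteq> - (\<Lambda> - {0})"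
  proof (rule image_subsetI)
    fix a assume "a \<in> - (\<Lambda> - {0})"
    then show "- a \<in> - (\<Lambda> - {0})" using lattice_minus_iff[of a] by (simp del: lattice_minus_iff)
  qed
  then have "lambert_sum j \<circ> uminus holomorphic_on - (\<Lambda> - {0})"
    by (intro holomorphic_on_compose_gen[OF _ lambert_sum_holomorphic]) (auto intro!: holomorphic_intros)
  then show ?thesis by (simp add: o_def)
qed

lemma lambert_sum_period: "lambert_sum j (a + 1) = lambert_sum j a"
  by (simp add: lambert_sum_def lambert_period)

text \<open>Translation by \<open>tau\<close> replaces xi_k by xi_(k+1), so the weight k^j becomes
  (k-1)^j, which is expanded binomially. For j = 1, 2 the new weight of the first term is 0; for j =
  0 that term has to be subtracted.\<close>

lemma lambert_sum_shift:
  "lambert_sum 0 (a + tau) = lambert_sum 0 a - lambert 0 (a + tau)"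
  "lambert_sum 1 (a + tau) = lambert_sum 1 a - lambert_sum 0 a"
  "lambert_sum 2 (a + tau) = lambert_sum 2 a - 2 * lambert_sum 1 a + lambert_sum 0 a"
proof -
  note sm = lambert_sum_summable[of 0 a] lambert_sum_summable[of 1 a] lambert_sum_summable[of 2 a]
  let ?L = "\<lambda>k. lambert (Suc k) a"
  have s: "summable ?L" "summable (\<lambda>k. of_nat (Suc k) * ?L k)" "summable (\<lambda>k. of_nat (Suc k) ^ 2 * ?L k)"
    using sm by simp_all
  have h: "lambert_sum 0 a = suminf ?L" "lambert_sum 1 a = (\<Sum>k. of_nat (Suc k) * ?L k)" "lambert_sum 2 a = (\<Sum>k. of_nat (Suc k) ^ 2 * ?L k)"
    by (simp_all add: lambert_sum_def)
  show "lambert_sum 0 (a + tau) = lambert_sum 0 a - lambert 0 (a + tau)"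
    using suminf_split_head[OF s(1)] by (simp add: lambert_sum_def lambert_shift)
  have 1: "(\<lambda>k. of_nat k * ?L k) = (\<lambda>k. of_nat (Suc k) * ?L k - ?L k)"
    by (simp add: algebra_simps)
  have 2: "(\<lambda>k. of_nat k ^ 2 * ?L k) = (\<lambda>k. of_nat (Suc k) ^ 2 * ?L k - 2 * (of_nat (Suc k) * ?L k) + ?L k)"
    by (simp add: algebra_simps power2_eq_square)
  have "lambert_sum 1 (a + tau) = (\<Sum>k. of_nat (Suc k) * ?L (Suc k))"
    by (simp add: lambert_sum_def lambert_shift)
  also have "\<dots> = (\<Sum>k. of_nat k * ?L k) - of_nat 0 * ?L 0"
    by (rule suminf_split_head) (unfold 1, intro summable_diff s)
  also have "\<dots> = lambert_sum 1 a - lambert_sum 0 a"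
    unfolding 1 h by (subst suminf_diff[OF s(2,1)]) simp
  finally show "lambert_sum 1 (a + tau) = lambert_sum 1 a - lambert_sum 0 a" .
  have "lambert_sum 2 (a + tau) = (\<Sum>k. of_nat (Suc k) ^ 2 * ?L (Suc k))"
    by (simp add: lambert_sum_def lambert_shift)
  also have "\<dots> = (\<Sum>k. of_nat k ^ 2 * ?L k) - of_nat 0 ^ 2 * ?L 0"
    by (rule suminf_split_head) (unfold 2, intro summable_add summable_diff summable_mult s)
  also have "\<dots> = lambert_sum 2 a - 2 * lambert_sum 1 a + lambert_sum 0 a"
  proof -
    have "(\<lambda>k. of_nat (Suc k) ^ 2 * ?L k - 2 * (of_nat (Suc k) * ?L k) + ?L k) sums
        (lambert_sum 2 a - 2 * lambert_sum 1 a + lambert_sum 0 a)"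
      unfolding h by (intro sums_add sums_diff sums_mult summable_sums s)
    then show ?thesis unfolding 2 by (simp add: sums_unique[symmetric])
  qed
  finally show "lambert_sum 2 (a + tau) = lambert_sum 2 a - 2 * lambert_sum 1 a + lambert_sum 0 a" .
qed

lemma lambert_sum_shift_uminus:
  "lambert_sum 0 (- (a + tau)) = lambert_sum 0 (- a) + lambert 0 (- a)"
  "lambert_sum 1 (- (a + tau)) = lambert_sum 1 (- a) + lambert_sum 0 (- a) + lambert 0 (- a)"
  "lambert_sum 2 (- (a + tau)) = lambert_sum 2 (- a) + 2 * lambert_sum 1 (- a) + lambert_sum 0 (- a) + lambert 0 (- a)"
proof -
  have [simp]: "- (a + tau) + tau = - a" by simp
  note h = lambert_sum_shift[of "- (a + tau)", unfolded \<open>- (a + tau) + tau = - a\<close>]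
  show 0: "lambert_sum 0 (- (a + tau)) = lambert_sum 0 (- a) + lambert 0 (- a)"
    using h(1) by (simp add: algebra_simps)
  show 1: "lambert_sum 1 (- (a + tau)) = lambert_sum 1 (- a) + lambert_sum 0 (- a) + lambert 0 (- a)"
    using h(2) unfolding 0 by (simp add: algebra_simps)
  show "lambert_sum 2 (- (a + tau)) = lambert_sum 2 (- a) + 2 * lambert_sum 1 (- a) + lambert_sum 0 (- a) + lambert 0 (- a)"
    using h(3) unfolding 0 1 by (simp add: algebra_simps)
qed

text \<open>The Lambert expansion of T with weights (k + s)^2 and (k - s)^2 is
  \<open>S\<^sub>2\<close> + 2s \<open>S\<^sub>1\<close> + s^2 \<open>S\<^sub>0\<close> up to the
  factor and the polynomial in s. The term k = 0 has weight s^2 and so enters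
  \<open>S\<^sub>0\<close> alone.\<close>

definition S\<^sub>0 :: "complex \<Rightarrow> complex" where "S\<^sub>0 a = lambert 0 a + lambert_sum 0 a - lambert_sum 0 (- a)"
definition S\<^sub>1 :: "complex \<Rightarrow> complex" where "S\<^sub>1 a = lambert_sum 1 a + lambert_sum 1 (- a)"
definition S\<^sub>2 :: "complex \<Rightarrow> complex" where "S\<^sub>2 a = lambert_sum 2 a - lambert_sum 2 (- a)"

lemma S_period: "S\<^sub>0 (a + 1) = S\<^sub>0 a" "S\<^sub>1 (a + 1) = S\<^sub>1 a" "S\<^sub>2 (a + 1) = S\<^sub>2 a"
proof -
  have "lambert_sum j (- (a + 1)) = lambert_sum j (- a)" for j
    using lambert_sum_period[of j "- (a + 1)"] by simp
  then show "S\<^sub>0 (a + 1) = S\<^sub>0 a" "S\<^sub>1 (a + 1) = S\<^sub>1 a" "S\<^sub>2 (a + 1) = S\<^sub>2 a"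
    by (simp_all only: S\<^sub>0_def S\<^sub>1_def S\<^sub>2_def lambert_sum_period lambert_period)
qed

lemma S_shift:
  assumes "a \<notin> \<Lambda>"
  shows "S\<^sub>0 (a + tau) = S\<^sub>0 a + 1"
    "S\<^sub>1 (a + tau) = S\<^sub>1 a - S\<^sub>0 a - 1"
    "S\<^sub>2 (a + tau) = S\<^sub>2 a - 2 * S\<^sub>1 a + S\<^sub>0 a + 1"
  unfolding S\<^sub>0_def S\<^sub>1_def S\<^sub>2_def lambert_sum_shift lambert_sum_shift_uminus lambert_0_uminus[OF assms]
  by (simp_all add: algebra_simps)

lemma S_uminus:
  assumes "a \<notin> \<Lambda>"
  shows "S\<^sub>0 (- a) = - 1 - S\<^sub>0 a" "S\<^sub>2 (- a) = - S\<^sub>2 a"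
  unfolding S\<^sub>0_def S\<^sub>2_def lambert_0_uminus[OF assms] by (simp_all add: algebra_simps)

section \<open>Lambert expansions in terms of the zeta function normalised to period 1\<close>

definition zeta_hat :: "complex \<Rightarrow> complex" where "zeta_hat a = wzeta tau a - eta1 tau * a"

lemma isCont_if_holomorphic_near_0: "f holomorphic_on - (\<Lambda> - {0}) \<Longrightarrow> isCont f 0"
  using open_compl_nonzero_lattice
  by (metis ComplI DiffD2 continuous_on_eq_continuous_at holomorphic_on_imp_continuous_on insertI1)

lemma tendsto_if_holomorphic_near_0: "f holomorphic_on - (\<Lambda> - {0}) \<Longrightarrow> (f \<longlongrightarrow> f 0) (at 0)"
  using isCont_if_holomorphic_near_0 by (simp add: isCont_def)

lemma quotient_tendsto_near_0:
  assumes "f holomorphic_on - (\<Lambda> - {0})" "f 0 = 0"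
  obtains c where "((\<lambda>a. f a / a) \<longlongrightarrow> c) (at 0)"
proof -
  have "f field_differentiable at 0"
    using assms open_compl_nonzero_lattice
    by (metis ComplI DiffD2 holomorphic_on_imp_differentiable_at insertI1)
  then obtain c where "(f has_field_derivative c) (at 0)" by (auto simp: field_differentiable_def)
  then have "((\<lambda>a. (f a - f 0) / (a - 0)) \<longlongrightarrow> c) (at 0)"
    by (simp only: has_field_derivative_iff)
  then show ?thesis using assms that by simp
qed

definition zeta_hat_reg :: "complex \<Rightarrow> complex" where "zeta_hat_reg a = zeta_reg a - eta1 tau * a"

lemma zeta_hat_eq: "zeta_hat a = 1 / a + zeta_hat_reg a"
  by (simp add: zeta_hat_def zeta_hat_reg_def wzeta_eq)

lemma zeta_hat_reg_holomorphic: "zeta_hat_reg holomorphic_on - (\<Lambda> - {0})"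
  unfolding zeta_hat_reg_def[abs_def] by (intro holomorphic_intros zeta_reg_holomorphic)

lemma zeta_hat_reg_0: "zeta_hat_reg 0 = 0"
  by (simp add: zeta_hat_reg_def zeta_reg_0)

lemma compl_lattice_subset: "- \<Lambda> \<subseteq> - (\<Lambda> - {0})" by blast

lemma zeta_hat_holomorphic: "zeta_hat holomorphic_on - \<Lambda>"
  unfolding zeta_hat_def[abs_def] by (intro holomorphic_intros wzeta_holomorphic)

lemma zeta_hat_odd: "zeta_hat (- a) = - zeta_hat a"
  by (simp add: zeta_hat_def wzeta_odd)

lemma zeta_hat_period: "a \<notin> \<Lambda> \<Longrightarrow> zeta_hat (a + 1) = zeta_hat a"
  unfolding zeta_hat_def wzeta_shift_1 by (simp add: algebra_simps)

lemma lambert_0_holomorphic: "lambert 0 holomorphic_on - \<Lambda>"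
  unfolding lambert_def[abs_def]
  by (intro holomorphic_intros) (use nome_pow_0_neq_1 in \<open>auto simp: nome_pow_def[abs_def] intro!: holomorphic_intros\<close>)

lemma S_holomorphic:
  "S\<^sub>0 holomorphic_on - \<Lambda>"
  "S\<^sub>1 holomorphic_on - (\<Lambda> - {0})"
  "S\<^sub>2 holomorphic_on - (\<Lambda> - {0})"
  unfolding S\<^sub>0_def[abs_def] S\<^sub>1_def[abs_def] S\<^sub>2_def[abs_def]
  by (intro holomorphic_intros lambert_sum_holomorphic lambert_sum_uminus_holomorphic lambert_0_holomorphic
      holomorphic_on_subset[OF lambert_sum_holomorphic compl_lattice_subset]
      holomorphic_on_subset[OF lambert_sum_uminus_holomorphic compl_lattice_subset])+

text \<open>At 0 the residue 1 of \<open>zeta_hat\<close> cancels the residue of 2 pi i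
  \<open>S\<^sub>0\<close>. The sum has period 1, so it is constant; its increment along
  \<open>tau\<close> must then vanish, and this is Legendre's relation.\<close>

lemma
  shows legendre: "eta2 tau = eta1 tau * tau - 2 * of_real pi * \<i>"
    and zeta_hat_series: "a \<notin> \<Lambda> \<Longrightarrow> zeta_hat a = - of_real pi * \<i> - 2 * of_real pi * \<i> * S\<^sub>0 a"
proof -
  let ?f = "\<lambda>a. zeta_hat a + 2 * of_real pi * \<i> * S\<^sub>0 a"
  obtain c :: complex where "((\<lambda>w. exp w / (1 - exp w) + 1 / w) \<longlongrightarrow> c) (at 0)"
    using lambert_kernel_at_0 .
  then have c: "((\<lambda>w. exp w / (1 - exp w) + 1 / w) \<longlongrightarrow> c) (at (2 * of_real pi * \<i> * 0))"
    by simp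
  have "((\<lambda>a. exp (2 * of_real pi * \<i> * a) / (1 - exp (2 * of_real pi * \<i> * a)) + 1 / (2 * of_real pi * \<i> * a)) \<longlongrightarrow> c) (at 0)"
  proof (rule filterlim_compose[OF c])
    show "filterlim (\<lambda>a. 2 * of_real pi * \<i> * a) (at (2 * of_real pi * \<i> * 0)) (at 0)"
      unfolding filterlim_at
      by (auto simp: eventually_at intro!: tendsto_eq_intros exI[of _ 1])
  qed
  then have "((\<lambda>a. 2 * of_real pi * \<i> * (exp (2 * of_real pi * \<i> * a) / (1 - exp (2 * of_real pi * \<i> * a)) + 1 / (2 * of_real pi * \<i> * a))
      + zeta_hat_reg a + 2 * of_real pi * \<i> * (lambert_sum 0 a - lambert_sum 0 (- a))) \<longlongrightarrow>
      2 * of_real pi * \<i> * c + zeta_hat_reg 0 + 2 * of_real pi * \<i> * (lambert_sum 0 0 - lambert_sum 0 (- 0))) (at 0)"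
    by (intro tendsto_intros tendsto_if_holomorphic_near_0 zeta_hat_reg_holomorphic lambert_sum_holomorphic lambert_sum_uminus_holomorphic)
  then have lim: "(?f \<longlongrightarrow> 2 * of_real pi * \<i> * c + zeta_hat_reg 0 + 2 * of_real pi * \<i> * (lambert_sum 0 0 - lambert_sum 0 (- 0))) (at 0)"
  proof (rule Lim_transform_eventually)
    show "\<forall>\<^sub>F a in at 0. 2 * of_real pi * \<i> * (exp (2 * of_real pi * \<i> * a) / (1 - exp (2 * of_real pi * \<i> * a)) + 1 / (2 * of_real pi * \<i> * a))
      + zeta_hat_reg a + 2 * of_real pi * \<i> * (lambert_sum 0 a - lambert_sum 0 (- a)) = ?f a"
      using eventually_neq_at_within[of 0 0 UNIV]
    proof eventually_elim
      case (elim a)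
      have "2 * of_real pi * \<i> * (1 / (2 * of_real pi * \<i> * a)) = 1 / a" by simp
      then show ?case
        by (simp add: zeta_hat_eq S\<^sub>0_def lambert_def nome_pow_def distrib_left right_diff_distrib)
    qed
  qed
  have hol: "?f holomorphic_on - \<Lambda>"
    by (intro holomorphic_intros zeta_hat_holomorphic S_holomorphic)
  have 1: "?f (a + 1) = ?f a + 0" if "a \<notin> \<Lambda>" for a
    using that by (simp add: zeta_hat_period S_period)
  have 2: "?f (a + tau) = ?f a + (eta2 tau - eta1 tau * tau + 2 * of_real pi * \<i>)" if "a \<notin> \<Lambda>" for a
    using that by (simp add: zeta_hat_def wzeta_shift_tau S_shift algebra_simps)
  note lin = quasi_periodic_linear[OF hol 1 2 lim]
  show "eta2 tau = eta1 tau * tau - 2 * of_real pi * \<i>"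
    using lin(2) by (simp add: algebra_simps add_eq_0_iff)
  assume a: "a \<notin> \<Lambda>"
  \<comment> \<open>The constant follows from parity: \<open>zeta_hat\<close> is odd, whereas
    \<open>S\<^sub>0\<close> is odd only up to the summand -1.\<close>
  have "?f (- a) = ?f a" using lin(1)[of a] lin(1)[of "- a"] a by simp
  then have "2 * (zeta_hat a) = 2 * (- of_real pi * \<i> - 2 * of_real pi * \<i> * S\<^sub>0 a)"
    unfolding zeta_hat_odd S_uminus[OF a] by (simp add: algebra_simps) (algebra)
  then show "zeta_hat a = - of_real pi * \<i> - 2 * of_real pi * \<i> * S\<^sub>0 a"
    by (rule mult_left_cancel[THEN iffD1, rotated]) simp
qed

lemma zeta_hat_shift: "a \<notin> \<Lambda> \<Longrightarrow> zeta_hat (a + tau) = zeta_hat a - 2 * of_real pi * \<i>"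
  by (simp add: zeta_hat_def wzeta_shift_tau legendre algebra_simps)

lemma S\<^sub>0_eq: "a \<notin> \<Lambda> \<Longrightarrow> S\<^sub>0 a = - 1/2 + \<i> * zeta_hat a / (2 * of_real pi)"
proof -
  assume "a \<notin> \<Lambda>"
  have "\<i> * zeta_hat a / (2 * of_real pi) = 1/2 + S\<^sub>0 a"
    unfolding zeta_hat_series[OF \<open>a \<notin> \<Lambda>\<close>] by (simp add: field_simps)
  then show ?thesis by simp
qed

text \<open>The double poles cancel, and 2 \<open>zeta_hat_reg a\<close> / a has a limit since
  \<open>zeta_hat_reg\<close> vanishes at 0. Both sides are even, so parity says nothing about
  \<open>c\<close>; it is determined later from the cubic combination.\<close>

lemma quadratic_series_aux:
  obtains c where "\<And>a. a \<notin> \<Lambda> \<Longrightarrow> zeta_hat a ^ 2 - wp tau a = c + 8 * of_real pi ^ 2 * S\<^sub>1 a"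
proof -
  let ?f = "\<lambda>a. zeta_hat a ^ 2 - wp tau a - 8 * of_real pi ^ 2 * S\<^sub>1 a"
  obtain d where d: "((\<lambda>a. zeta_hat_reg a / a) \<longlongrightarrow> d) (at 0)"
    using quotient_tendsto_near_0[OF zeta_hat_reg_holomorphic zeta_hat_reg_0] .
  have "((\<lambda>a. 2 * (zeta_hat_reg a / a) + zeta_hat_reg a ^ 2 - wp_reg a - 8 * of_real pi ^ 2 * S\<^sub>1 a) \<longlongrightarrow>
      2 * d + zeta_hat_reg 0 ^ 2 - wp_reg 0 - 8 * of_real pi ^ 2 * S\<^sub>1 0) (at 0)"
    by (intro tendsto_intros d tendsto_if_holomorphic_near_0 zeta_hat_reg_holomorphic wp_reg_holomorphic S_holomorphic)
  then have lim: "(?f \<longlongrightarrow> 2 * d + zeta_hat_reg 0 ^ 2 - wp_reg 0 - 8 * of_real pi ^ 2 * S\<^sub>1 0) (at 0)"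
  proof (rule Lim_transform_eventually)
    show "\<forall>\<^sub>F a in at 0. 2 * (zeta_hat_reg a / a) + zeta_hat_reg a ^ 2 - wp_reg a - 8 * of_real pi ^ 2 * S\<^sub>1 a = ?f a"
      using eventually_neq_at_within[of 0 0 UNIV]
      by eventually_elim (simp add: zeta_hat_eq wp_eq power2_eq_square algebra_simps)
  qed
  have hol: "?f holomorphic_on - \<Lambda>"
    by (intro holomorphic_intros zeta_hat_holomorphic wp_holomorphic
        holomorphic_on_subset[OF S_holomorphic(2) compl_lattice_subset])
  have 1: "?f (a + 1) = ?f a + 0" if "a \<notin> \<Lambda>" for a
    using that by (simp add: zeta_hat_period S_period wp_periodic)
  have 2: "?f (a + tau) = ?f a + 0" if "a \<notin> \<Lambda>" for a
    using that
    by (simp add: zeta_hat_shift S_shift wp_periodic S\<^sub>0_eq power2_eq_square algebra_simps)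
  from quasi_periodic_linear(1)[OF hol 1 2 lim] show ?thesis
    by (intro that[of "2 * d + zeta_hat_reg 0 ^ 2 - wp_reg 0 - 8 * of_real pi ^ 2 * S\<^sub>1 0"])
       (simp add: diff_eq_eq)
qed

text \<open>The cubic combination minus its Lambert sum has period 1, so its increment along
  \<open>tau\<close> must be 0. That increment is linear in the unknown \<open>c\<close> of the
  quadratic expansion and yields c = -2 pi^2/3. The remaining constant is 0 because the combination
  is odd.\<close>

lemma
  assumes a: "a \<notin> \<Lambda>"
  shows quadratic_series: "zeta_hat a ^ 2 - wp tau a = - 2/3 * of_real pi ^ 2 + 8 * of_real pi ^ 2 * S\<^sub>1 a"
    and cubic_series: "zeta_hat a ^ 3 - 3 * wp tau a * zeta_hat a - wp' tau a = 24 * of_real pi ^ 3 * \<i> * S\<^sub>2 a"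
proof -
  obtain c where c: "\<And>a. a \<notin> \<Lambda> \<Longrightarrow> zeta_hat a ^ 2 - wp tau a = c + 8 * of_real pi ^ 2 * S\<^sub>1 a"
    using quadratic_series_aux by blast
  let ?f = "\<lambda>a. zeta_hat a ^ 3 - 3 * wp tau a * zeta_hat a - wp' tau a - 24 * of_real pi ^ 3 * \<i> * S\<^sub>2 a"
  obtain d where d: "((\<lambda>a. zeta_hat_reg a / a) \<longlongrightarrow> d) (at 0)"
    using quotient_tendsto_near_0[OF zeta_hat_reg_holomorphic zeta_hat_reg_0] .
  obtain d' where d': "((\<lambda>a. wp_reg a / a) \<longlongrightarrow> d') (at 0)"
    using quotient_tendsto_near_0[OF wp_reg_holomorphic wp_reg_0] .
  define l where "l = 3 * zeta_hat_reg 0 * d + zeta_hat_reg 0 ^ 3 - 3 * d' - 3 * wp_reg 0 * zeta_hat_reg 0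
      - wp_reg' 0 - 24 * of_real pi ^ 3 * \<i> * S\<^sub>2 0"
  have "((\<lambda>a. 3 * zeta_hat_reg a * (zeta_hat_reg a / a) + zeta_hat_reg a ^ 3 - 3 * (wp_reg a / a) - 3 * wp_reg a * zeta_hat_reg a
      - wp_reg' a - 24 * of_real pi ^ 3 * \<i> * S\<^sub>2 a) \<longlongrightarrow> l) (at 0)"
    unfolding l_def
    by (intro tendsto_intros d d' tendsto_if_holomorphic_near_0 zeta_hat_reg_holomorphic
        wp_reg_holomorphic wp_reg'_holomorphic S_holomorphic)
  then have lim: "(?f \<longlongrightarrow> l) (at 0)"
  proof (rule Lim_transform_eventually)
    show "\<forall>\<^sub>F a in at 0. 3 * zeta_hat_reg a * (zeta_hat_reg a / a) + zeta_hat_reg a ^ 3 - 3 * (wp_reg a / a)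
        - 3 * wp_reg a * zeta_hat_reg a - wp_reg' a - 24 * of_real pi ^ 3 * \<i> * S\<^sub>2 a = ?f a"
      using eventually_neq_at_within[of 0 0 UNIV] eventually_not_in_lattice[of 0]
    proof eventually_elim
      case (elim a)
      \<comment> \<open>The poles of order three cancel as 1 - 3 + 2 = 0, and those of order two as
        3x/a^2 - 3x/a^2. What remains contains only x/a and y/a, which have limits.\<close>
      have eq: "3 * x * (x / a) + x ^ 3 - 3 * (y / a) - 3 * y * x - z =
          (1 / a + x) ^ 3 - 3 * (1 / a ^ 2 + y) * (1 / a + x) - (- 2 / a ^ 3 + z)" for x y z :: complex
      proof -
        define b where "b = 1 / a"
        have "1 / a ^ 2 = b ^ 2" "- 2 / a ^ 3 = - 2 * b ^ 3" "x / a = x * b" "y / a = y * b"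
          by (simp_all add: b_def power_divide)
        then show ?thesis unfolding b_def[symmetric]
          by (simp add: power2_eq_square power3_eq_cube algebra_simps)
      qed
      show ?case
        unfolding zeta_hat_eq wp_eq wp'_eq[OF elim(2)] eq[of "zeta_hat_reg a" "wp_reg a" "wp_reg' a"] ..
    qed
  qed
  have hol: "?f holomorphic_on - \<Lambda>"
    by (intro holomorphic_intros zeta_hat_holomorphic wp_holomorphic wp'_holomorphic
        holomorphic_on_subset[OF S_holomorphic(3) compl_lattice_subset])
  have 1: "?f (a + 1) = ?f a + 0" if "a \<notin> \<Lambda>" for a
    using that by (simp add: zeta_hat_period S_period wp_periodic wp'_periodic)
  have 2: "?f (a + tau) = ?f a + (- 6 * of_real pi * \<i> * c - 4 * \<i> * of_real pi ^ 3)" if a: "a \<notin> \<Lambda>" for a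
  proof -
    have z: "zeta_hat a = - of_real pi * \<i> - 2 * of_real pi * \<i> * S\<^sub>0 a"
      by (rule zeta_hat_series[OF a])
    have w: "wp tau a = zeta_hat a ^ 2 - (c + 8 * of_real pi ^ 2 * S\<^sub>1 a)"
      using c[OF a] by (simp add: algebra_simps)
    have i: "\<i>^2 = -1" by simp
    show ?thesis
      unfolding zeta_hat_shift[OF a] S_shift[OF a] wp_periodic[OF a tau_in_lattice] wp'_periodic[OF a tau_in_lattice] w z
      using i by algebra
  qed
  note lin = quasi_periodic_linear[OF hol 1 2 lim]
  have "c = - 2/3 * of_real pi ^ 2"
  proof -
    have "- 6 * of_real pi * \<i> * (c + 2/3 * of_real pi ^ 2) = 0"
      using lin(2) by (simp add: algebra_simps power2_eq_square power3_eq_cube)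
    then have "c + 2/3 * of_real pi ^ 2 = 0" by simp
    then show ?thesis by (simp add: add_eq_0_iff)
  qed
  then show "zeta_hat a ^ 2 - wp tau a = - 2/3 * of_real pi ^ 2 + 8 * of_real pi ^ 2 * S\<^sub>1 a"
    using c[OF a] by simp
  have "?f (- a) = - ?f a"
    unfolding zeta_hat_odd S_uminus[OF a] wp_even wp'_odd[OF a] by (simp add: algebra_simps)
  then have "?f a = 0" using lin(1)[of a] lin(1)[of "- a"] a by simp
  then show "zeta_hat a ^ 3 - 3 * wp tau a * zeta_hat a - wp' tau a = 24 * of_real pi ^ 3 * \<i> * S\<^sub>2 a"
    by simp
qed

end

section \<open>The denominator T and its zeros for imaginary modulus\<close>

definition denom :: "real \<Rightarrow> real \<Rightarrow> complex \<Rightarrow> complex" where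
  "denom r s tau = (let a = of_real r + of_real s * tau; Z = Zrs r s tau in Z^3 - 3 * wp tau a * Z - wp' tau a)"

context upper_half_plane
begin

lemma Zrs_eq: "Zrs r s tau = zeta_hat (of_real r + of_real s * tau) + 2 * of_real pi * \<i> * of_real s"
  by (simp add: Zrs_def zeta_hat_def legendre algebra_simps)

text \<open>T is expanded in powers of s about \<open>zeta_hat a\<close>: the coefficient of s is 6
  pi i times the quadratic combination, that of s^2 is -12 pi^2 \<open>zeta_hat a\<close>. The
  constants of the three expansions and the term (2 pi i s)^3 assemble to the multiple of
  B_3(s)/3.\<close>

lemma denom_series:
  fixes r s :: real
  defines "a \<equiv> of_real r + of_real s * tau"
  assumes a: "a \<notin> \<Lambda>"
  shows "denom r s tau = 24 * of_real pi ^ 3 * \<i> *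
     (S\<^sub>2 a + 2 * of_real s * S\<^sub>1 a + of_real s ^ 2 * S\<^sub>0 a - of_real ((s - 3 * s^2 + 2 * s^3) / 6))"
proof -
  let ?z = "zeta_hat a"
  define p :: complex where "p = of_real pi"
  define t :: complex where "t = of_real s"
  have q: "wp tau a = ?z ^ 2 - (- 2/3 * p ^ 2 + 8 * p ^ 2 * S\<^sub>1 a)"
    using quadratic_series[OF a] by (simp add: algebra_simps p_def)
  have c: "wp' tau a = ?z ^ 3 - 3 * wp tau a * ?z - 24 * p ^ 3 * \<i> * S\<^sub>2 a"
    using cubic_series[OF a] by (simp add: algebra_simps p_def)
  have z: "?z = - p * \<i> - 2 * p * \<i> * S\<^sub>0 a"
    using zeta_hat_series[OF a] by (simp add: p_def)
  have "denom r s tau = (?z + 2 * p * \<i> * t) ^ 3 - 3 * wp tau a * (?z + 2 * p * \<i> * t) - wp' tau a"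
    by (simp add: denom_def Let_def Zrs_eq a_def p_def t_def)
  also have "\<dots> = 24 * p ^ 3 * \<i> * (S\<^sub>2 a + 2 * t * S\<^sub>1 a + t ^ 2 * S\<^sub>0 a - (t - 3 * t^2 + 2 * t^3) / 6)"
  proof -
    have i: "\<i>^2 = -1" by simp
    have six: "6 * ((t - 3 * t^2 + 2 * t^3) / 6) = t - 3 * t^2 + 2 * t^3" by simp
    have third: "3 * (- 2/3 * p ^ 2) = - 2 * p ^ 2" by simp
    show ?thesis unfolding c q z
      using i six third by algebra
  qed
  finally show ?thesis by (simp add: p_def t_def)
qed

end

lemma Im_divide_one_minus: "e \<noteq> 1 \<Longrightarrow> Im (e / (1 - e)) = Im e / norm (1 - e) ^ 2"
proof -
  assume "e \<noteq> 1"
  then have "1 - e \<noteq> 0" by auto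
  then have "e / (1 - e) = 1 / (1 - e) - 1" by (simp add: divide_simps)
  also have "Im \<dots> = Im e / norm (1 - e) ^ 2"
    by (simp add: Im_divide cmod_power2)
  finally show ?thesis .
qed

context upper_half_plane
begin

text \<open>Up to the factor 24 pi^3 i, the real part of T is the imaginary part of the bracket in
  \<open>denom_series\<close>. There the polynomial in s drops out, and sin(2 pi r) times a positive
  number is left.\<close>

lemma denom_eq_0_imp:
  assumes Re: "Re tau = 0" and a: "of_real r + of_real s * tau \<notin> \<Lambda>" and 0: "denom r s tau = 0"
  shows "2 * r \<in> \<int>"
proof -
  define a where "a = of_real r + of_real s * tau"
  have a': "a \<notin> \<Lambda>" "- a \<notin> \<Lambda>" using a lattice_minus_iff[of a] by (simp_all only: a_def not_False_eq_True)
  define w where "w = (\<lambda>k a. norm (nome_pow k a) / norm (1 - nome_pow k a) ^ 2)"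
  \<comment> \<open>As \<open>tau\<close> is imaginary, (s' + k) \<open>tau\<close> affects only the
    modulus of \<open>nome_pow k\<close>; its argument is 2 pi r' for every k.\<close>
  have Im_l: "Im (lambert k (of_real r' + of_real s' * tau)) = sin (2 * pi * r') * w k (of_real r' + of_real s' * tau)"
    if "nome_pow k (of_real r' + of_real s' * tau) \<noteq> 1" for k r' s'
  proof -
    let ?a = "of_real r' + of_real s' * tau"
    have "Im (nome_pow k ?a) = norm (nome_pow k ?a) * sin (2 * pi * r')"
      using Re by (simp add: nome_pow_def norm_exp_eq_Re Im_exp algebra_simps)
    then show ?thesis
      using Im_divide_one_minus[OF that] by (simp add: lambert_def w_def)
  qed
  have Im_a: "Im (lambert (Suc k) a) = sin (2 * pi * r) * w (Suc k) a" for k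
    using Im_l[of "Suc k" r s] nome_pow_neq_1[of a k] a' by (simp add: a_def)
  have Im_ma: "Im (lambert (Suc k) (- a)) = - sin (2 * pi * r) * w (Suc k) (- a)" for k
    using Im_l[of "Suc k" "- r" "- s"] nome_pow_neq_1[of "- a" k] a' by (simp add: a_def)
  have Im_0: "Im (lambert 0 a) = sin (2 * pi * r) * w 0 a"
    using Im_l[of 0 r s] nome_pow_0_neq_1[of a] a' by (simp add: a_def)
  \<comment> \<open>The sums at \<open>a\<close> and \<open>- a\<close> are subtracted, and the
    angle at \<open>- a\<close> is -2 pi r, so both contributions carry the same sign.\<close>
  define P where "P = (\<lambda>k. (real (Suc k) + s) ^ 2 * w (Suc k) a + (real (Suc k) - s) ^ 2 * w (Suc k) (- a))"
  have lambert_sum_sums: "(\<lambda>k. of_nat (Suc k) ^ j * lambert (Suc k) a) sums lambert_sum j a" for j a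
    unfolding lambert_sum_def by (rule summable_sums[OF lambert_sum_summable])
  have "(\<lambda>k. (of_nat (Suc k) ^ 2 * lambert (Suc k) a + 2 * of_real s * (of_nat (Suc k) ^ 1 * lambert (Suc k) a)
        + of_real s ^ 2 * (of_nat (Suc k) ^ 0 * lambert (Suc k) a)) -
      (of_nat (Suc k) ^ 2 * lambert (Suc k) (- a) - 2 * of_real s * (of_nat (Suc k) ^ 1 * lambert (Suc k) (- a))
        + of_real s ^ 2 * (of_nat (Suc k) ^ 0 * lambert (Suc k) (- a)))) sums
      ((lambert_sum 2 a + 2 * of_real s * lambert_sum 1 a + of_real s ^ 2 * lambert_sum 0 a) -
       (lambert_sum 2 (- a) - 2 * of_real s * lambert_sum 1 (- a) + of_real s ^ 2 * lambert_sum 0 (- a)))" (is "?F sums ?S")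
    by (intro sums_add sums_diff sums_mult lambert_sum_sums)
  then have "(\<lambda>k. Im (?F k)) sums Im ?S" by (rule sums_Im)
  moreover have "Im (?F k) = sin (2 * pi * r) * P k" for k
  proof -
    have "?F k = of_real ((real (Suc k) + s) ^ 2) * lambert (Suc k) a - of_real ((real (Suc k) - s) ^ 2) * lambert (Suc k) (- a)"
      by (simp add: power2_eq_square algebra_simps)
    also have "Im \<dots> = sin (2 * pi * r) * P k"
      unfolding P_def by (simp add: Im_a Im_ma algebra_simps del: of_real_power of_nat_Suc)
    finally show ?thesis .
  qed
  ultimately have sums: "(\<lambda>k. sin (2 * pi * r) * P k) sums Im ?S" by simp
  have "S\<^sub>2 a + 2 * of_real s * S\<^sub>1 a + of_real s ^ 2 * S\<^sub>0 a - of_real ((s - 3 * s^2 + 2 * s^3) / 6) = 0"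
    using denom_series[OF a] 0 by (simp add: a_def)
  then have "Im (S\<^sub>2 a + 2 * of_real s * S\<^sub>1 a + of_real s ^ 2 * S\<^sub>0 a) = 0"
    by (metis Im_complex_of_real eq_iff_diff_eq_0)
  moreover have "S\<^sub>2 a + 2 * of_real s * S\<^sub>1 a + of_real s ^ 2 * S\<^sub>0 a = of_real (s ^ 2) * lambert 0 a + ?S"
    by (simp add: S\<^sub>0_def S\<^sub>1_def S\<^sub>2_def algebra_simps)
  ultimately have Im0: "s ^ 2 * (sin (2 * pi * r) * w 0 a) + Im ?S = 0"
    by (simp add: Im_0 del: of_real_power)
  have "sin (2 * pi * r) = 0"
  proof (rule ccontr)
    assume nz: "sin (2 * pi * r) \<noteq> 0"
    have Ps: "P sums (Im ?S / sin (2 * pi * r))"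
      using sums_mult[OF sums, of "1 / sin (2 * pi * r)"] nz by simp
    have wpos: "w (Suc k) b > 0" if "b \<notin> \<Lambda>" for b k
    proof -
      have "nome_pow (Suc k) b \<noteq> 1" using that by (intro nome_pow_neq_1) auto
      moreover have "nome_pow (Suc k) b \<noteq> 0" by (simp add: nome_pow_def)
      ultimately show ?thesis by (simp add: w_def)
    qed
    \<comment> \<open>The numbers k+1+s and k+1-s add up to 2(k+1) > 0, so at most one of the two
      squares vanishes.\<close>
    have "P k > 0" for k
    proof (cases "real (Suc k) + s = 0")
      case True
      then have "real (Suc k) - s \<noteq> 0" by linarith
      then show ?thesis unfolding P_def
        by (intro add_nonneg_pos mult_pos_pos mult_nonneg_nonneg less_imp_le[OF wpos] wpos a') auto
    next
      case False
      then show ?thesis unfolding P_def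
        by (intro add_pos_nonneg mult_pos_pos mult_nonneg_nonneg less_imp_le[OF wpos] wpos a') auto
    qed
    then have "suminf P > 0" using Ps by (intro suminf_pos) (auto simp: sums_iff)
    then have 1: "Im ?S / sin (2 * pi * r) > 0" using Ps by (simp add: sums_iff)
    have "w 0 a \<ge> 0" by (simp add: w_def)
    then have "s ^ 2 * w 0 a + Im ?S / sin (2 * pi * r) > 0"
      using 1 by (intro add_nonneg_pos mult_nonneg_nonneg) auto
    moreover have "s ^ 2 * w 0 a + Im ?S / sin (2 * pi * r) = 0"
      using Im0 nz by (simp add: field_simps)
    ultimately show False by simp
  qed
  then obtain i :: int where "2 * pi * r = of_int i * pi" using sin_zero_iff_int2 by blast
  then have "2 * r = of_int i" by simp
  then show ?thesis by simp
qed

text \<open>Summing over the point set removes the basis from the formula, so two bases of one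
  lattice can be compared.\<close>

lemma infsum_lat: "infsum (\<lambda>p. f (lat tau p)) I\<^sub>0 = infsum f (\<Lambda> - {0})"
proof -
  have "lat tau ` I\<^sub>0 = \<Lambda> - {0}"
    using inj_lat by (auto simp: lat_eq_0_iff lat_eq image_set_diff)
  moreover have "inj_on (lat tau) I\<^sub>0" using inj_lat by (rule inj_on_subset) auto
  ultimately show ?thesis using infsum_reindex[of "lat tau" I\<^sub>0 f] by (simp add: o_def)
qed

end

section \<open>Similar lattices\<close>

text \<open>The lattices are equated as sets. This covers a scaling combined with an arbitrary
  change of basis: 1 and \<open>tau\<close> need not correspond to 1 and
  \<open>tau'\<close>.\<close>

locale lattice_similarity = L: upper_half_plane tau + L': upper_half_plane tau'
  for tau tau' :: complex +
  fixes c :: complex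
  assumes c: "c \<noteq> 0" and lattice_eq: "lattice tau = (*) c ` lattice tau'"
begin

lemma mult_in_lattice_iff: "c * z \<in> lattice tau \<longleftrightarrow> z \<in> lattice tau'"
  using c unfolding lattice_eq by auto

lemma infsum_similar: "infsum f (lattice tau - {0}) = infsum (\<lambda>w. f (c * w)) (lattice tau' - {0})"
proof -
  have "lattice tau - {0} = (*) c ` (lattice tau' - {0})"
    unfolding lattice_eq using c by auto
  moreover have "inj_on ((*) c) (lattice tau' - {0})" using c by (auto simp: inj_on_def)
  ultimately show ?thesis by (simp add: infsum_reindex o_def)
qed

lemma wp_similar: "wp tau (c * z) = wp tau' z / c^2"
proof -
  have "wp tau (c * z) = 1 / (c * z)^2 + infsum (\<lambda>w. 1 / (c * z - c * w)^2 - 1 / (c * w)^2) (lattice tau' - {0})"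
    unfolding wp_def
    using L.infsum_lat[of "\<lambda>w. 1 / (c * z - w)^2 - 1 / w^2"] infsum_similar by simp
  also have "(\<lambda>w. 1 / (c * z - c * w)^2 - 1 / (c * w)^2) = (\<lambda>w. (1 / c^2) * (1 / (z - w)^2 - 1 / w^2))"
  proof
    fix w
    have "(c * z - c * w)^2 = c^2 * (z - w)^2" "(c * w)^2 = c^2 * w^2"
      by (simp_all add: right_diff_distrib[symmetric] power_mult_distrib)
    then show "1 / (c * z - c * w)^2 - 1 / (c * w)^2 = (1 / c^2) * (1 / (z - w)^2 - 1 / w^2)"
      by (simp add: right_diff_distrib)
  qed
  also have "infsum \<dots> (lattice tau' - {0}) = (1 / c^2) * infsum (\<lambda>w. 1 / (z - w)^2 - 1 / w^2) (lattice tau' - {0})"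
    by (rule infsum_cmult_right')
  also have "1 / (c * z)^2 + \<dots> = wp tau' z / c^2"
    unfolding wp_def
    using L'.infsum_lat[of "\<lambda>w. 1 / (z - w)^2 - 1 / w^2"]
    by (simp add: power_mult_distrib add_divide_distrib)
  finally show ?thesis .
qed

lemma wzeta_similar: "wzeta tau (c * z) = wzeta tau' z / c"
proof -
  have "wzeta tau (c * z) = 1 / (c * z) + infsum (\<lambda>w. 1 / (c * z - c * w) + 1 / (c * w) + (c * z) / (c * w)^2) (lattice tau' - {0})"
    unfolding wzeta_def
    using L.infsum_lat[of "\<lambda>w. 1 / (c * z - w) + 1 / w + (c * z) / w^2"] infsum_similar by simp
  also have "(\<lambda>w. 1 / (c * z - c * w) + 1 / (c * w) + (c * z) / (c * w)^2) = (\<lambda>w. (1 / c) * (1 / (z - w) + 1 / w + z / w^2))"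
  proof
    fix w
    have "1 / (c * z - c * w) = (1 / c) * (1 / (z - w))" by (simp add: right_diff_distrib[symmetric])
    moreover have "(c * z) / (c * w)^2 = (1 / c) * (z / w^2)"
      using c by (simp add: power2_eq_square)
    ultimately show "1 / (c * z - c * w) + 1 / (c * w) + (c * z) / (c * w)^2 = (1 / c) * (1 / (z - w) + 1 / w + z / w^2)"
      by (simp add: distrib_left)
  qed
  also have "infsum \<dots> (lattice tau' - {0}) = (1 / c) * infsum (\<lambda>w. 1 / (z - w) + 1 / w + z / w^2) (lattice tau' - {0})"
    by (rule infsum_cmult_right')
  also have "1 / (c * z) + \<dots> = wzeta tau' z / c"
    unfolding wzeta_def
    using L'.infsum_lat[of "\<lambda>w. 1 / (z - w) + 1 / w + z / w^2"]
    by (simp add: add_divide_distrib mult.commute)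
  finally show ?thesis .
qed

lemma wp'_similar:
  assumes "z \<notin> lattice tau'"
  shows "wp' tau (c * z) = wp' tau' z / c^3"
proof -
  have "wp tau = (\<lambda>u. wp tau' (u / c) / c^2)"
  proof
    fix u show "wp tau u = wp tau' (u / c) / c^2" using wp_similar[of "u / c"] c by simp
  qed
  moreover have "((\<lambda>u. wp tau' (u / c) / c^2) has_field_derivative (wp' tau' z * (1 / c)) / c^2) (at (c * z))"
  proof (rule DERIV_cdivide, rule DERIV_chain2[of "wp tau'"])
    show "(wp tau' has_field_derivative wp' tau' z) (at (c * z / c))"
      using L'.wp_has_field_derivative[OF assms] c by simp
    show "((\<lambda>u. u / c) has_field_derivative 1 / c) (at (c * z))"
      using c by (auto intro!: derivative_eq_intros)
  qed
  ultimately have "(wp tau has_field_derivative (wp' tau' z * (1 / c)) / c^2) (at (c * z))" by simp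
  then have "wp' tau (c * z) = (wp' tau' z * (1 / c)) / c^2"
    unfolding wp'_def[of tau] by (rule DERIV_imp_deriv)
  then show ?thesis by (simp add: power2_eq_square power3_eq_cube)
qed

text \<open>Under a change of basis the quasi-periods transform with the same integers as the
  periods 1 and \<open>tau\<close>. The correction r eta1 + s eta2 therefore depends only on the
  point, although r and s depend on the basis.\<close>

lemma Zrs_similar:
  assumes "of_real r + of_real s * tau = c * (of_real x + of_real y * tau')"
  shows "Zrs r s tau = Zrs x y tau' / c"
proof -
  obtain m n where mn: "1 = c * lat tau' (m, n)" using L.one_in_lattice lattice_eq by auto
  obtain m' n' where mn': "tau = c * lat tau' (m', n')" using L.tau_in_lattice lattice_eq by auto
  \<comment> \<open>A base point away from the poles, at which the quasi-periods of both lattices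
    are compared.\<close>
  define z where "z = (1/2 :: complex)"
  have z: "z \<notin> lattice tau'" unfolding z_def by (rule L'.half_not_in_lattice)
  then have cz: "c * z \<notin> lattice tau" by (simp only: mult_in_lattice_iff not_False_eq_True)
  have "wzeta tau (c * z + 1) = wzeta tau' (z + lat tau' (m, n)) / c"
    using wzeta_similar[of "z + lat tau' (m, n)"] by (simp add: distrib_left mn[symmetric])
  then have e1: "eta1 tau = (of_int m * eta1 tau' + of_int n * eta2 tau') / c"
    unfolding L.wzeta_shift_1[OF cz] L'.wzeta_shift[OF z] wzeta_similar
    by (simp add: add_divide_distrib)
  have "wzeta tau (c * z + tau) = wzeta tau' (z + lat tau' (m', n')) / c"
    using wzeta_similar[of "z + lat tau' (m', n')"] by (simp add: distrib_left mn'[symmetric])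
  then have e2: "eta2 tau = (of_int m' * eta1 tau' + of_int n' * eta2 tau') / c"
    unfolding L.wzeta_shift_tau[OF cz] L'.wzeta_shift[OF z] wzeta_similar
    by (simp add: add_divide_distrib)
  have "c * (of_real x + of_real y * tau') = of_real r * (c * lat tau' (m, n)) + of_real s * (c * lat tau' (m', n'))"
    using assms mn mn' by simp
  also have "\<dots> = c * (of_real (r * of_int m + s * of_int m') + of_real (r * of_int n + s * of_int n') * tau')"
    by (simp add: lat_eq algebra_simps)
  finally have "of_real x + of_real y * tau' = of_real (r * of_int m + s * of_int m') + of_real (r * of_int n + s * of_int n') * tau'"
    using c by simp
  then have xy: "x = r * of_int m + s * of_int m'" "y = r * of_int n + s * of_int n'"
    unfolding L'.combination_eq_iff by simp_all
  show ?thesis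
    unfolding Zrs_def assms wzeta_similar e1 e2
    by (simp add: xy diff_divide_distrib add_divide_distrib algebra_simps)
qed

text \<open>Z, \<open>wp\<close> and \<open>wp'\<close> are homogeneous of degrees -1, -2 and -3, so
  each term of T has degree -3.\<close>

lemma denom_similar:
  assumes "of_real r + of_real s * tau = c * (of_real x + of_real y * tau')"
    and "of_real x + of_real y * tau' \<notin> lattice tau'"
  shows "denom r s tau = denom x y tau' / c^3"
  unfolding denom_def Let_def Zrs_similar[OF assms(1)] assms(1) wp_similar wp'_similar[OF assms(2)]
  by (simp add: diff_divide_distrib power_divide power2_eq_square power3_eq_cube)

end

section \<open>Real cross-ratio and rectangular lattices\<close>

text \<open>The difference D satisfies D'' = 6(f + g)D with vanishing initial data. By Leibniz' rule
  and strong induction all derivatives of D at \<open>h\<close> vanish, and the identity theorem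
  extends this to \<open>S\<close>.\<close>

lemma ode_unique_holomorphic:
  assumes S: "open S" "connected S" "h \<in> S"
    and f: "\<And>z. z \<in> S \<Longrightarrow> (f has_field_derivative f' z) (at z)" "\<And>z. z \<in> S \<Longrightarrow> (f' has_field_derivative 6 * f z ^ 2 + K) (at z)"
    and g: "\<And>z. z \<in> S \<Longrightarrow> (g has_field_derivative g' z) (at z)" "\<And>z. z \<in> S \<Longrightarrow> (g' has_field_derivative 6 * g z ^ 2 + K) (at z)"
    and init: "f h = g h" "f' h = (g' h :: complex)"
    and z: "z \<in> S"
  shows "f z = g z"
proof -
  define D where "D = (\<lambda>z. f z - g z)"
  define q where "q = (\<lambda>z. 6 * (f z + g z))"
  have hf: "f holomorphic_on S" and hg: "g holomorphic_on S"
    using S f(1) g(1) by (auto simp: holomorphic_on_open)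
  have hD: "D holomorphic_on S" and hq: "q holomorphic_on S"
    unfolding D_def q_def by (intro holomorphic_intros hf hg)+
  have D1: "(D has_field_derivative f' z - g' z) (at z)" if "z \<in> S" for z
    unfolding D_def by (intro DERIV_diff f g that)
  then have dD: "deriv D z = f' z - g' z" if "z \<in> S" for z
    using that DERIV_imp_deriv by blast
  have D2: "deriv (deriv D) z = q z * D z" if z: "z \<in> S" for z
  proof -
    have "((\<lambda>z. f' z - g' z) has_field_derivative (6 * f z ^ 2 + K) - (6 * g z ^ 2 + K)) (at z)"
      by (intro DERIV_diff f g z)
    then have "(deriv D has_field_derivative (6 * f z ^ 2 + K) - (6 * g z ^ 2 + K)) (at z)"
      by (rule has_field_derivative_transform_within_open[OF _ S(1) z]) (simp add: dD)
    then show ?thesis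
      unfolding q_def D_def by (simp add: DERIV_imp_deriv power2_eq_square algebra_simps)
  qed
  have "(deriv ^^ n) D h = 0" for n
  proof (induction n rule: less_induct)
    case (less n)
    consider "n = 0" | "n = 1" | m where "n = Suc (Suc m)"
      by (metis One_nat_def not0_implies_Suc)
    then show ?case
    proof cases
      case 1
      then show ?thesis using init by (simp add: D_def)
    next
      case 2
      then show ?thesis using init S dD by simp
    next
      case 3
      have "(deriv ^^ n) D h = (deriv ^^ m) (deriv (deriv D)) h"
        by (simp add: 3 funpow_swap1)
      also have "\<dots> = (deriv ^^ m) (\<lambda>z. q z * D z) h"
        using S D2 by (intro higher_deriv_transform_within_open[of _ S])
          (auto intro!: holomorphic_deriv holomorphic_intros hD hq)
      also have "\<dots> = (\<Sum>i=0..m. of_nat (m choose i) * (deriv ^^ i) q h * (deriv ^^ (m - i)) D h)"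
        by (rule higher_deriv_mult[OF hq hD S(1,3)])
      also have "\<dots> = 0"
        by (intro sum.neutral ballI) (simp add: less 3)
      finally show ?thesis .
    qed
  qed
  then have "D z = 0"
    using holomorphic_fun_eq_0_on_connected[OF hD S(1,2) _ S(3) z] by blast
  then show ?thesis by (simp add: D_def)
qed

text \<open>Discreteness makes the set of positive elements closed, so its infimum \<open>A\<close>
  is a positive element of \<open>G\<close>; division with remainder by \<open>A\<close> leaves
  remainder 0.\<close>

lemma real_discrete_subgroup:
  fixes G :: "real set"
  assumes diff: "\<And>x y. x \<in> G \<Longrightarrow> y \<in> G \<Longrightarrow> x - y \<in> G"
    and e: "e > 0" "\<And>x. x \<in> G \<Longrightarrow> x \<noteq> 0 \<Longrightarrow> e \<le> \<bar>x\<bar>"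
    and nontriv: "x0 \<in> G" "x0 \<noteq> 0"
  obtains A where "A > 0" "G = range (\<lambda>k::int. of_int k * A)"
proof -
  have zero: "0 \<in> G" using diff[OF nontriv(1) nontriv(1)] by simp
  have neg: "- x \<in> G" if "x \<in> G" for x using diff[OF zero that] by simp
  have add: "x + y \<in> G" if "x \<in> G" "y \<in> G" for x y using diff[OF that(1) neg[OF that(2)]] by simp
  let ?P = "{x \<in> G. x > 0}"
  have ne: "?P \<noteq> {}" using nontriv neg[of x0] by (cases "x0 > 0") auto
  have bdd: "bdd_below ?P" by (rule bdd_belowI[of _ 0]) auto
  have "closed ?P"
  proof (rule discrete_imp_closed[OF e(1)], intro ballI impI)
    fix x y assume "x \<in> ?P" "y \<in> ?P" "dist y x < e"
    then have "\<bar>y - x\<bar> < e" "y - x \<in> G" by (auto simp: dist_real_def intro: diff)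
    then show "y = x" using e(2)[of "y - x"] by auto
  qed
  define A where "A = Inf ?P"
  have A: "A \<in> G" "A > 0"
    using closed_contains_Inf[OF ne bdd \<open>closed ?P\<close>] by (auto simp: A_def)
  have mult: "of_int k * A \<in> G" for k :: int
  proof (induction k rule: int_induct[where k = 0])
    case (step1 i) then show ?case using add[OF step1(2) A(1)] by (simp add: algebra_simps)
  next
    case (step2 i) then show ?case using diff[OF step2(2) A(1)] by (simp add: algebra_simps)
  qed (use zero in auto)
  have "x \<in> range (\<lambda>k::int. of_int k * A)" if x: "x \<in> G" for x
  proof -
    let ?k = "\<lfloor>x / A\<rfloor>"
    have d: "x - of_int ?k * A \<in> G" using diff[OF x mult] .
    have b: "0 \<le> x - of_int ?k * A" "x - of_int ?k * A < A"
      using floor_divide_lower[OF A(2), of x] floor_divide_upper[OF A(2), of x]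
      by (simp_all add: algebra_simps)
    have "x - of_int ?k * A = 0"
    proof (rule ccontr)
      assume "x - of_int ?k * A \<noteq> 0"
      then have "x - of_int ?k * A \<in> ?P" using d b by simp
      then have "A \<le> x - of_int ?k * A" unfolding A_def using bdd by (intro cInf_lower)
      then show False using b by simp
    qed
    then have "x = of_int ?k * A" by simp
    then show ?thesis by blast
  qed
  then have "G = range (\<lambda>k::int. of_int k * A)" using mult by blast
  then show ?thesis using that A by blast
qed

section \<open>The differential equation of wp and mirror symmetries of the lattice\<close>

context upper_half_plane
begin

text \<open>\<open>wp_reg\<close> is even and vanishes at 0, so it vanishes there to second order.
  This controls the cross term of \<open>wp\<close>^2 in the differential equation.\<close>

lemma wp_reg_div_square_tendsto:
  obtains c where "((\<lambda>z. wp_reg z / z ^ 2) \<longlongrightarrow> c) (at 0)"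
proof -
  have "((\<lambda>z. wp_reg (- z)) has_field_derivative wp_reg' (- 0) * - 1) (at 0)"
    by (rule DERIV_chain2[of wp_reg]) (auto intro!: wp_reg_has_field_derivative derivative_eq_intros)
  then have "(wp_reg has_field_derivative - wp_reg' 0) (at 0)" by (simp add: wp_reg_even)
  then have "- wp_reg' 0 = wp_reg' 0"
    using wp_reg_has_field_derivative[of 0] DERIV_unique by blast
  then have "wp_reg' 0 = 0" by simp
  then have d0: "(wp_reg has_field_derivative 0) (at 0)"
    using wp_reg_has_field_derivative[of 0] by simp
  then have lim: "((\<lambda>z. wp_reg z / z) \<longlongrightarrow> 0) (at 0)"
    using wp_reg_0 by (simp add: has_field_derivative_iff)
  define g where "g = (\<lambda>z. if z = 0 then 0 else wp_reg z / z)"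
  have "g holomorphic_on - (\<Lambda> - {0})"
    unfolding g_def
  proof (rule removable_singularity[OF _ open_compl_nonzero_lattice lim])
    show "(\<lambda>z. wp_reg z / z) holomorphic_on - (\<Lambda> - {0}) - {0}"
      by (intro holomorphic_intros holomorphic_on_subset[OF wp_reg_holomorphic]) auto
  qed
  then obtain c where c: "((\<lambda>z. g z / z) \<longlongrightarrow> c) (at 0)"
    using quotient_tendsto_near_0[of g] by (auto simp: g_def)
  have "((\<lambda>z. wp_reg z / z ^ 2) \<longlongrightarrow> c) (at 0)"
    using c by (rule Lim_transform_eventually)
      (use eventually_neq_at_within[of 0 0 UNIV] in \<open>eventually_elim, simp add: g_def power2_eq_square\<close>)
  then show ?thesis by (rule that)
qed

lemma wp'_has_field_derivative_deriv: "z \<notin> \<Lambda> \<Longrightarrow> (wp' tau has_field_derivative deriv (wp' tau) z) (at z)"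
  by (rule holomorphic_derivI[OF wp'_holomorphic open_compl_lattice]) auto

text \<open>In wp'' - 6 wp^2 the poles 6/z^4 cancel and the cross term 12 \<open>wp_reg z\<close> /
  z^2 has a limit, so the doubly periodic function is constant. Classically K = -g2/2; below K is
  expressed through the values at half periods.\<close>

lemma wp_ode:
  obtains K where "\<And>z. z \<notin> \<Lambda> \<Longrightarrow> (wp' tau has_field_derivative 6 * wp tau z ^ 2 + K) (at z)"
proof -
  let ?f = "\<lambda>z. deriv (wp' tau) z - 6 * wp tau z ^ 2"
  have hol: "?f holomorphic_on - \<Lambda>"
    by (intro holomorphic_intros holomorphic_deriv wp'_holomorphic wp_holomorphic open_compl_lattice)
  have per: "?f (z + w) = ?f z + 0" if z: "z \<notin> \<Lambda>" and w: "w \<in> \<Lambda>" for z w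
  proof -
    have "((\<lambda>z. wp' tau (z + w)) has_field_derivative deriv (wp' tau) (z + w)) (at z)"
      by (rule derivative_shift_lattice[OF wp'_has_field_derivative_deriv z w])
    then have "(wp' tau has_field_derivative deriv (wp' tau) (z + w)) (at z)"
      by (rule has_field_derivative_transform_within_open[OF _ open_compl_lattice])
         (use z w wp'_periodic in auto)
    then have "deriv (wp' tau) (z + w) = deriv (wp' tau) z"
      using DERIV_imp_deriv by fastforce
    then show ?thesis using wp_periodic[OF z w] by simp
  qed
  obtain c where c: "((\<lambda>z. wp_reg z / z ^ 2) \<longlongrightarrow> c) (at 0)"
    using wp_reg_div_square_tendsto .
  have dreg: "deriv wp_reg' holomorphic_on - (\<Lambda> - {0})"
    by (intro holomorphic_deriv wp_reg'_holomorphic open_compl_nonzero_lattice)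
  have "((\<lambda>z. deriv wp_reg' z - 12 * (wp_reg z / z ^ 2) - 6 * wp_reg z ^ 2) \<longlongrightarrow>
      deriv wp_reg' 0 - 12 * c - 6 * wp_reg 0 ^ 2) (at 0)"
    by (intro tendsto_intros c tendsto_if_holomorphic_near_0 dreg wp_reg_holomorphic)
  then have lim: "(?f \<longlongrightarrow> deriv wp_reg' 0 - 12 * c - 6 * wp_reg 0 ^ 2) (at 0)"
  proof (rule Lim_transform_eventually)
    show "\<forall>\<^sub>F z in at 0. deriv wp_reg' z - 12 * (wp_reg z / z ^ 2) - 6 * wp_reg z ^ 2 = ?f z"
      using eventually_not_in_lattice[of 0]
    proof eventually_elim
      case (elim z)
      then have nz: "z \<noteq> 0" by (metis zero_in_lattice)
      have d: "(wp_reg' has_field_derivative deriv wp_reg' z) (at z)"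
        by (rule holomorphic_derivI[OF wp_reg'_holomorphic open_compl_nonzero_lattice]) (use elim in auto)
      have "((\<lambda>z. - 2 * (1 / z ^ 3)) has_field_derivative - 2 * (- 3 / z ^ 4)) (at z)"
        by (rule DERIV_cmult) (use nz in \<open>auto intro!: derivative_eq_intros simp: eval_nat_numeral\<close>)
      then have "((\<lambda>z. - 2 / z ^ 3) has_field_derivative 6 / z ^ 4) (at z)" by simp
      then have "((\<lambda>z. - 2 / z ^ 3 + wp_reg' z) has_field_derivative 6 / z ^ 4 + deriv wp_reg' z) (at z)"
        by (intro DERIV_add d)
      then have "(wp' tau has_field_derivative 6 / z ^ 4 + deriv wp_reg' z) (at z)"
        by (rule has_field_derivative_transform_within_open[OF _ open_compl_lattice])
           (use elim wp'_eq in auto)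
      then have e: "deriv (wp' tau) z = 6 / z ^ 4 + deriv wp_reg' z" by (rule DERIV_imp_deriv)
      have "(1 / z ^ 2 + x) ^ 2 = 1 / z ^ 4 + 2 * (x / z ^ 2) + x ^ 2" for x
        by (simp add: power2_eq_square power4_eq_xxxx algebra_simps)
      then show ?case unfolding e wp_eq by simp
    qed
  qed
  let ?K = "deriv wp_reg' 0 - 12 * c - 6 * wp_reg 0 ^ 2"
  have "?f z = 0 * z + ?K" if "z \<notin> \<Lambda>" for z
    by (rule quasi_periodic_linear(1)[OF hol _ _ lim that])
       (use per one_in_lattice tau_in_lattice in blast)+
  then have "deriv (wp' tau) z = 6 * wp tau z ^ 2 + ?K" if "z \<notin> \<Lambda>" for z
    using that by (simp add: diff_eq_eq add.commute)
  then show ?thesis using that[of ?K] wp'_has_field_derivative_deriv by simp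
qed

lemma wp'_half_period:
  assumes "h \<notin> \<Lambda>" "2 * h \<in> \<Lambda>"
  shows "wp' tau h = 0"
proof -
  have "wp' tau (- h + 2 * h) = wp' tau (- h)"
    using assms by (intro wp'_periodic) auto
  then have "wp' tau h = - wp' tau h" using wp'_odd[OF assms(1)] by simp
  then show ?thesis by simp
qed

text \<open>u^2 wp(u) tends to 1, whereas a finite limit of \<open>wp\<close> would make it tend to
  0.\<close>

lemma wp_unbounded_at_0: "\<not> (wp tau \<longlongrightarrow> l) (at 0)"
proof
  assume l: "(wp tau \<longlongrightarrow> l) (at 0)"
  have "((\<lambda>u. u ^ 2 * wp tau u) \<longlongrightarrow> 0 ^ 2 * l) (at 0)"
    by (intro tendsto_intros l)
  moreover have "((\<lambda>u. 1 + u ^ 2 * wp_reg u) \<longlongrightarrow> 1 + 0 ^ 2 * wp_reg 0) (at 0)"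
    by (intro tendsto_intros tendsto_if_holomorphic_near_0 wp_reg_holomorphic)
  then have "((\<lambda>u. u ^ 2 * wp tau u) \<longlongrightarrow> 1 + 0 ^ 2 * wp_reg 0) (at 0)"
    by (rule Lim_transform_eventually)
       (use eventually_neq_at_within[of 0 0 UNIV] in \<open>eventually_elim, simp add: wp_eq distrib_left\<close>)
  ultimately have "0 ^ 2 * l = 1 + 0 ^ 2 * wp_reg 0"
    by (rule tendsto_unique[rotated]) simp
  then show False by simp
qed

text \<open>Reflecting \<open>wp\<close> in the line through \<open>h\<close> fixed by \<open>u \<mapsto> h + cnj (\<epsilon> * (u - h))\<close> gives a solution
  of the same differential equation with the same initial data, so the poles are symmetric too.\<close>

lemma reflected_half_period_in_lattice:
  assumes ode: "\<And>z. z \<notin> \<Lambda> \<Longrightarrow> (wp' tau has_field_derivative 6 * wp tau z ^ 2 + K) (at z)"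
    and eps: "norm \<epsilon> = 1" "\<epsilon> ^ 4 * cnj K = K" "\<epsilon> ^ 2 * cnj (wp tau h) = wp tau h"
    and h: "h \<notin> \<Lambda>" "2 * h \<in> \<Lambda>"
  shows "h - cnj (\<epsilon> * h) \<in> \<Lambda>"
proof (rule ccontr)
  assume contr: "h - cnj (\<epsilon> * h) \<notin> \<Lambda>"
  define \<rho> where "\<rho> = (\<lambda>u. h + cnj (\<epsilon> * (u - h)))"
  have ee: "\<epsilon> * cnj \<epsilon> = 1" using eps(1) by (simp add: complex_norm_square[symmetric])
  have inv: "\<rho> (\<rho> u) = u" for u
  proof -
    have "\<rho> (\<rho> u) = h + (\<epsilon> * cnj \<epsilon>) * (u - h)"
      unfolding \<rho>_def by simp
    then show ?thesis by (simp add: ee)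
  qed
  have cont: "continuous_on UNIV \<rho>" unfolding \<rho>_def by (intro continuous_intros)
  define S where "S = - \<Lambda> \<inter> \<rho> -` (- \<Lambda>)"
  have oS: "open S"
    unfolding S_def using open_vimage[OF open_compl_lattice cont] open_compl_lattice by (intro open_Int)
  have "countable (\<Lambda> \<union> \<rho> ` \<Lambda>)" by simp
  then have "connected (UNIV - (\<Lambda> \<union> \<rho> ` \<Lambda>))"
    by (intro connected_open_diff_countable) (auto simp: connected_UNIV)
  moreover have "UNIV - (\<Lambda> \<union> \<rho> ` \<Lambda>) = S"
  proof -
    have "u \<in> \<rho> ` \<Lambda> \<longleftrightarrow> \<rho> u \<in> \<Lambda>" for u
      using inv by (metis imageE imageI)
    then show ?thesis unfolding S_def by blast
  qed
  ultimately have cS: "connected S" by simp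
  have hS: "h \<in> S" using h by (simp add: S_def \<rho>_def)
  \<comment> \<open>Each differentiation of a function reflected by \<open>\<rho>\<close> produces
    one factor \<open>\<epsilon>\<close>. The weight \<open>\<epsilon> ^ 2\<close> makes both g''
    and g^2 carry \<open>\<epsilon> ^ 4\<close>, so \<open>g\<close> solves the same equation
    exactly when \<open>\<epsilon> ^ 4 * cnj K = K\<close>.\<close>
  define g where "g = (\<lambda>u. \<epsilon> ^ 2 * cnj (wp tau (\<rho> u)))"
  define g' where "g' = (\<lambda>u. \<epsilon> ^ 3 * cnj (wp' tau (\<rho> u)))"
  have refl: "((\<lambda>u. cnj (F (\<rho> u))) has_field_derivative \<epsilon> * cnj F') (at u)"
    if "(F has_field_derivative F') (at (\<rho> u))" for F F' u
  proof -
    let ?l = "\<lambda>u. cnj h + \<epsilon> * (u - h)"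
    have "(cnj \<circ> F \<circ> cnj has_field_derivative cnj F') (at (?l u))"
      using that by (intro has_field_derivative_cnj_cnj) (simp add: \<rho>_def)
    then have "((\<lambda>u. (cnj \<circ> F \<circ> cnj) (?l u)) has_field_derivative cnj F' * \<epsilon>) (at u)"
      by (rule DERIV_chain2) (auto intro!: derivative_eq_intros)
    then show ?thesis by (simp add: \<rho>_def o_def mult.commute)
  qed
  have eq: "wp tau u = g u" if "u \<in> S" for u
  proof (rule ode_unique_holomorphic[OF oS cS hS, of "wp tau" "wp' tau" K g g'])
    fix u assume "u \<in> S"
    then have u: "u \<notin> \<Lambda>" "\<rho> u \<notin> \<Lambda>" by (auto simp: S_def)
    show "(wp tau has_field_derivative wp' tau u) (at u)"
      by (rule wp_has_field_derivative[OF u(1)])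
    show "(wp' tau has_field_derivative 6 * wp tau u ^ 2 + K) (at u)"
      by (rule ode[OF u(1)])
    show "(g has_field_derivative g' u) (at u)"
      using DERIV_cmult[OF refl[OF wp_has_field_derivative[OF u(2)]], of "\<epsilon> ^ 2"]
      by (simp add: g_def g'_def power2_eq_square power3_eq_cube mult.assoc)
    have "6 * g u ^ 2 + K = \<epsilon> ^ 3 * (\<epsilon> * cnj (6 * wp tau (\<rho> u) ^ 2 + K))"
      by (subst eps(2)[symmetric]) (simp add: g_def eval_nat_numeral algebra_simps)
    then show "(g' has_field_derivative 6 * g u ^ 2 + K) (at u)"
      using DERIV_cmult[OF refl[OF ode[OF u(2)]], of "\<epsilon> ^ 3"] by (simp add: g'_def)
  next
    show "wp tau h = g h" using eps(3) by (simp add: g_def \<rho>_def)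
    show "wp' tau h = g' h" using wp'_half_period[OF h] by (simp add: g'_def \<rho>_def)
  qed (rule that)
  \<comment> \<open>The contradiction comes from the pole at 0: its mirror image is h -
    cnj(\<epsilon> h), and if this is not a pole, then \<open>g\<close> is continuous at 0 while
    \<open>wp\<close> is not.\<close>
  have \<rho>0: "\<rho> 0 \<notin> \<Lambda>" using contr by (simp add: \<rho>_def)
  have "isCont (wp tau) (\<rho> 0)" using wp_has_field_derivative[OF \<rho>0] by (rule DERIV_isCont)
  moreover have "isCont \<rho> 0" using cont by (simp add: continuous_on_eq_continuous_at)
  ultimately have "isCont (\<lambda>u. wp tau (\<rho> u)) 0" by (rule isCont_o2[rotated])
  then have "isCont g 0" unfolding g_def by (intro continuous_intros)
  then have "(g \<longlongrightarrow> g 0) (at 0)" by (simp add: isCont_def)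
  then have "(wp tau \<longlongrightarrow> g 0) (at 0)"
  proof (rule Lim_transform_eventually)
    have "\<forall>\<^sub>F u in at 0. u \<in> \<rho> -` (- \<Lambda>)"
      using \<rho>0 open_vimage[OF open_compl_lattice cont] by (intro eventually_at_in_open') auto
    with eventually_not_in_lattice[of 0] show "\<forall>\<^sub>F u in at 0. g u = wp tau u"
      by eventually_elim (use eq in \<open>simp add: S_def\<close>)
  qed
  then show False using wp_unbounded_at_0 by blast
qed

text \<open>Real \<open>tfun\<close> makes the three half-period values real multiples of one number
  \<open>\<delta>\<close>. The reflection matching that line yields lattice elements that, after a
  rotation, are the real and imaginary parts of lattice elements.\<close>

lemma rectangular_if_tfun_real:
  assumes t: "tfun tau \<in> \<real>" "tfun tau \<noteq> 0" "tfun tau \<noteq> 1"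
  obtains c b where "c \<noteq> 0" "b > 0" "\<Lambda> = (*) c ` lattice (\<i> * of_real b)"
proof -
  obtain K where ode: "\<And>z. z \<notin> \<Lambda> \<Longrightarrow> (wp' tau has_field_derivative 6 * wp tau z ^ 2 + K) (at z)"
    using wp_ode by blast
  \<comment> \<open>The first integral of wp'' = 6 wp^2 + K. Since \<open>wp'\<close> vanishes at
    half periods, the three half-period values are roots of one cubic without quadratic term; as
    they are distinct, their sum is 0.\<close>
  let ?I = "\<lambda>z. wp' tau z ^ 2 - 4 * wp tau z ^ 3 - 2 * K * wp tau z"
  have I: "?I z = ?I w" if "z \<notin> \<Lambda>" "w \<notin> \<Lambda>" for z w
  proof (rule constant_on_compl_lattice[of ?I, OF _ that])
    fix z assume z: "z \<notin> \<Lambda>"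
    show "(?I has_field_derivative 0) (at z)"
      using wp_has_field_derivative[OF z] ode[OF z]
      by (auto intro!: derivative_eq_intros simp: algebra_simps power2_eq_square)
  qed
  define a1 where "a1 = e1 tau"
  define a2 where "a2 = e2 tau"
  define a3 where "a3 = e3 tau"
  define \<delta> where "\<delta> = a2 - a1"
  have two: "2 * (1/2) \<in> \<Lambda>" "2 * (tau/2) \<in> \<Lambda>" "2 * ((1 + tau)/2) \<in> \<Lambda>"
    using lattice_add[OF one_in_lattice tau_in_lattice] by (simp_all add: add_divide_distrib)
  have w': "wp' tau (1/2) = 0" "wp' tau (tau/2) = 0" "wp' tau ((1 + tau)/2) = 0"
    using wp'_half_period half_not_in_lattice two by blast+
  have I12: "4 * a1 ^ 3 + 2 * K * a1 = 4 * a2 ^ 3 + 2 * K * a2"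
    using I[OF half_not_in_lattice(1,2)] w' unfolding a1_def a2_def e1_def e2_def by algebra
  have I13: "4 * a1 ^ 3 + 2 * K * a1 = 4 * a3 ^ 3 + 2 * K * a3"
    using I[OF half_not_in_lattice(1,3)] w' unfolding a1_def a3_def e1_def e3_def by algebra
  have tf: "tfun tau = (a3 - a1) / \<delta>" by (simp add: tfun_def a1_def a2_def a3_def \<delta>_def)
  \<comment> \<open>For \<delta> = 0 the quotient defining \<open>tfun\<close> would be 0 by
    convention.\<close>
  have \<delta>: "\<delta> \<noteq> 0" using t(2) tf by auto
  obtain t where tr: "tfun tau = of_real t" using \<open>tfun tau \<in> \<real>\<close> by (elim Reals_cases)
  have d: "a3 - a1 = of_real t * \<delta>" using tf \<delta> tr by (simp add: field_simps)
  have "a3 \<noteq> a1" using t(2) tf by auto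
  have "a3 \<noteq> a2" using t(3) tf \<delta> by (auto simp: \<delta>_def)
  have "(a1 - a2) * (4 * (a1^2 + a1 * a2 + a2^2) + 2 * K) = 0" using I12 by algebra
  then have K1: "4 * (a1^2 + a1 * a2 + a2^2) + 2 * K = 0" using \<delta> by (simp add: \<delta>_def)
  have "(a1 - a3) * (4 * (a1^2 + a1 * a3 + a3^2) + 2 * K) = 0" using I13 by algebra
  then have K2: "4 * (a1^2 + a1 * a3 + a3^2) + 2 * K = 0" using \<open>a3 \<noteq> a1\<close> by simp
  have "(a2 - a3) * (a1 + a2 + a3) = 0" using K1 K2 by algebra
  then have sum: "a1 + a2 + a3 = 0" using \<open>a3 \<noteq> a2\<close> by simp
  \<comment> \<open>The solution of a2 - a1 = \<delta>, a3 - a1 = t \<delta>, a1 + a2 + a3 = 0, in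
    units of \<delta>.\<close>
  define s1 s2 :: real where "s1 = - (1 + t) / 3" and "s2 = (2 - t) / 3"
  have "3 * a1 = - (1 + of_real t) * \<delta>" using d sum \<delta>_def by algebra
  then have a1: "a1 = of_real s1 * \<delta>" by (simp add: s1_def field_simps)
  have "3 * a2 = (2 - of_real t) * \<delta>" using d sum \<delta>_def by algebra
  then have a2: "a2 = of_real s2 * \<delta>" by (simp add: s2_def field_simps)
  have K: "K = of_real (- 2 * (s1^2 + s1 * s2 + s2^2)) * \<delta>^2"
  proof -
    have "K = - 2 * (a1^2 + a1 * a2 + a2^2)" using K1 by algebra
    then show ?thesis unfolding a1 a2 by (simp add: power2_eq_square algebra_simps)
  qed
  \<comment> \<open>Chosen so that v \<mapsto> \<epsilon>^2 cnj v fixes the real line through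
    \<delta>, and hence \<open>a1\<close> and \<open>a2\<close>; squaring gives the condition on
    \<open>K\<close>.\<close>
  define \<epsilon> where "\<epsilon> = csqrt (\<delta> / cnj \<delta>)"
  have \<epsilon>2: "\<epsilon> ^ 2 = \<delta> / cnj \<delta>" by (simp add: \<epsilon>_def)
  have "norm \<epsilon> ^ 2 = 1" using \<delta> by (simp add: \<epsilon>2 norm_divide flip: norm_power)
  then have n\<epsilon>: "norm \<epsilon> = 1" by (simp add: power2_eq_1_iff) (use norm_ge_zero[of \<epsilon>] in linarith)
  have \<epsilon>r: "\<epsilon> ^ 2 * cnj (of_real x * \<delta>) = of_real x * \<delta>" for x
    using \<delta> by (simp add: \<epsilon>2)
  have "\<epsilon> ^ 4 = (\<delta> / cnj \<delta>) ^ 2" by (simp flip: \<epsilon>2 add: power_mult[symmetric])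
  then have \<epsilon>K: "\<epsilon> ^ 4 * cnj K = K"
    unfolding K using \<delta> by (simp add: power_divide)
  have R1: "1/2 - cnj (\<epsilon> * (1/2)) \<in> \<Lambda>"
    using two(1) half_not_in_lattice(1) \<epsilon>r[of s1] a1
    by (intro reflected_half_period_in_lattice[OF ode n\<epsilon> \<epsilon>K]) (auto simp: a1_def e1_def)
  have R2: "tau/2 - cnj (\<epsilon> * (tau/2)) \<in> \<Lambda>"
    using two(2) half_not_in_lattice(2) \<epsilon>r[of s2] a2
    by (intro reflected_half_period_in_lattice[OF ode n\<epsilon> \<epsilon>K]) (auto simp: a2_def e2_def)
  \<comment> \<open>The division by 2 is what the half periods contribute, and it separates
    rectangular lattices from rhombic ones. The condition is additive in \<open>w\<close>, so the
    two generators suffice.\<close>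
  have R: "(w - cnj (\<epsilon> * w)) / 2 \<in> \<Lambda>" if "w \<in> \<Lambda>" for w
  proof -
    obtain m n where w: "w = of_int m + of_int n * tau" using \<open>w \<in> \<Lambda>\<close> by (auto simp: lat_eq)
    have "of_int m * (1/2 - cnj (\<epsilon> * (1/2))) + of_int n * (tau/2 - cnj (\<epsilon> * (tau/2))) \<in> \<Lambda>"
      by (intro lattice_add lattice_int_mult R1 R2)
    also have "of_int m * (1/2 - cnj (\<epsilon> * (1/2))) + of_int n * (tau/2 - cnj (\<epsilon> * (tau/2))) = (w - cnj (\<epsilon> * w)) / 2"
      by (simp add: w field_simps)
    finally show ?thesis .
  qed
  \<comment> \<open>Rotation by \<mu> with \<mu>^2 = \<epsilon> turns w \<mapsto> cnj(\<epsilon> w)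
    into complex conjugation, and (z - cnj z)/2 is \<i> times the imaginary part of z.\<close>
  define \<mu> where "\<mu> = csqrt \<epsilon>"
  have \<mu>2: "\<mu> ^ 2 = \<epsilon>" by (simp add: \<mu>_def)
  have "norm \<mu> ^ 2 = 1" using n\<epsilon> by (simp add: \<mu>2 flip: norm_power)
  then have n\<mu>: "norm \<mu> = 1" by (simp add: power2_eq_1_iff) (use norm_ge_zero[of \<mu>] in linarith)
  have \<mu>0: "\<mu> \<noteq> 0" using n\<mu> by auto
  have \<mu>c: "\<mu> * cnj \<mu> = 1" using n\<mu> by (simp add: complex_norm_square[symmetric])
  let ?M = "(*) \<mu> ` \<Lambda>"
  have Im_M: "\<i> * of_real (Im z) \<in> ?M" and Re_M: "of_real (Re z) \<in> ?M" if z: "z \<in> ?M" for z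
  proof -
    obtain w where w: "z = \<mu> * w" "w \<in> \<Lambda>" using z by blast
    have "\<mu> * ((w - cnj (\<epsilon> * w)) / 2) = (\<mu> * w - (\<mu> * cnj \<mu>) * cnj (\<mu> * w)) / 2"
      by (simp add: \<mu>2[symmetric] power2_eq_square algebra_simps)
    also have "\<dots> = \<i> * of_real (Im z)"
      by (simp add: \<mu>c w(1)[symmetric] complex_eq_iff)
    finally have eq: "\<mu> * ((w - cnj (\<epsilon> * w)) / 2) = \<i> * of_real (Im z)" .
    then show "\<i> * of_real (Im z) \<in> ?M" using R[OF w(2)] by (metis imageI)
    have "of_real (Re z) = \<mu> * (w - (w - cnj (\<epsilon> * w)) / 2)"
      unfolding right_diff_distrib eq by (simp add: w(1)[symmetric] complex_eq_iff)
    moreover have "w - (w - cnj (\<epsilon> * w)) / 2 \<in> \<Lambda>" by (intro lattice_diff w R)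
    ultimately show "of_real (Re z) \<in> ?M" by (metis imageI)
  qed
  have M_diff: "x - y \<in> ?M" and M_add: "x + y \<in> ?M" if xy: "x \<in> ?M" "y \<in> ?M" for x y
  proof -
    obtain u v where "x = \<mu> * u" "y = \<mu> * v" "u \<in> \<Lambda>" "v \<in> \<Lambda>" using xy by blast
    then show "x - y \<in> ?M" "x + y \<in> ?M"
      using lattice_diff[of u v] lattice_add[of u v]
      by (simp_all only: right_diff_distrib[symmetric] distrib_left[symmetric] imageI)
  qed
  have M_sep: "sep \<le> norm x" if "x \<in> ?M" "x \<noteq> 0" for x
  proof -
    obtain p where "x = \<mu> * lat tau p" using \<open>x \<in> ?M\<close> by blast
    then show ?thesis using norm_lat_ge[of p] \<open>x \<noteq> 0\<close> n\<mu> by (auto simp: norm_mult lat_eq_0_iff)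
  qed
  have M1: "\<mu> \<in> ?M" "\<mu> * tau \<in> ?M"
    using imageI[OF one_in_lattice, of "(*) \<mu>"] imageI[OF tau_in_lattice, of "(*) \<mu>"] by simp_all
  have nontriv: "Re \<mu> \<noteq> 0 \<or> Re (\<mu> * tau) \<noteq> 0" "Im \<mu> \<noteq> 0 \<or> Im (\<mu> * tau) \<noteq> 0"
    using \<mu>0 Im_tau by (auto simp: complex_eq_iff)
  let ?G = "{x. of_real x \<in> ?M}" and ?G' = "{y. \<i> * of_real y \<in> ?M}"
  obtain A where A: "A > 0" "?G = range (\<lambda>k::int. of_int k * A)"
  proof -
    obtain x0 where "x0 \<in> ?G" "x0 \<noteq> 0"
      using nontriv(1) Re_M[OF M1(1)] Re_M[OF M1(2)] by blast
    moreover have "x - y \<in> ?G" if "x \<in> ?G" "y \<in> ?G" for x y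
      using M_diff[of "of_real x" "of_real y"] that by simp
    moreover have "sep \<le> \<bar>x\<bar>" if "x \<in> ?G" "x \<noteq> 0" for x
      using M_sep[of "of_real x"] that by simp
    ultimately show ?thesis using real_discrete_subgroup[of ?G sep x0] sep_pos that by blast
  qed
  obtain B where B: "B > 0" "?G' = range (\<lambda>k::int. of_int k * B)"
  proof -
    obtain x0 where "x0 \<in> ?G'" "x0 \<noteq> 0"
      using nontriv(2) Im_M[OF M1(1)] Im_M[OF M1(2)] by blast
    moreover have "x - y \<in> ?G'" if "x \<in> ?G'" "y \<in> ?G'" for x y
      using M_diff[of "\<i> * of_real x" "\<i> * of_real y"] that by (simp add: right_diff_distrib)
    moreover have "sep \<le> \<bar>x\<bar>" if "x \<in> ?G'" "x \<noteq> 0" for x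
      using M_sep[of "\<i> * of_real x"] that by (simp add: norm_mult)
    ultimately show ?thesis using real_discrete_subgroup[of ?G' sep x0] sep_pos that by blast
  qed
  \<comment> \<open>The rotated lattice contains the real and imaginary parts of its elements, so it
    is the direct sum of its real part, generated by \<open>A\<close>, and its imaginary part,
    generated by \<i> \<open>B\<close>.\<close>
  have "?M = (*) (of_real A) ` lattice (\<i> * of_real (B / A))"
  proof (intro equalityI subsetI)
    fix z assume z: "z \<in> ?M"
    obtain k where k: "Re z = of_int k * A" using Re_M[OF z] A(2) by blast
    obtain l where l: "Im z = of_int l * B" using Im_M[OF z] B(2) by blast
    have "z = of_real A * lat (\<i> * of_real (B / A)) (k, l)"
      using A(1) by (simp add: complex_eq_iff lat_eq k l)
    then show "z \<in> (*) (of_real A) ` lattice (\<i> * of_real (B / A))" by blast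
  next
    fix z assume "z \<in> (*) (of_real A) ` lattice (\<i> * of_real (B / A))"
    then obtain k l where "z = of_real A * lat (\<i> * of_real (B / A)) (k, l)" by auto
    then have z: "z = of_real (of_int k * A) + \<i> * of_real (of_int l * B)"
      using A(1) by (simp add: complex_eq_iff lat_eq)
    have "of_real (of_int k * A) \<in> ?M" "\<i> * of_real (of_int l * B) \<in> ?M"
      using A(2) B(2) by blast+
    then show "z \<in> ?M" unfolding z by (rule M_add)
  qed
  moreover have "\<Lambda> = (*) (1 / \<mu>) ` ?M" using \<mu>0 by (simp add: image_image)
  ultimately have "\<Lambda> = (*) (of_real A / \<mu>) ` lattice (\<i> * of_real (B / A))"
    by (simp add: image_image)
  moreover have "of_real A / \<mu> \<noteq> 0" "B / A > 0" using A B \<mu>0 by auto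
  ultimately show ?thesis using that by blast
qed

text \<open>A zero of T makes twice the first coordinate of the point integral in every rectangular
  basis. The two orders of the sides give both coordinates, so twice the point is a period, against
  the hypothesis on r and s.\<close>

lemma denom_nonzero:
  assumes t: "tfun tau \<in> \<real>" "tfun tau \<noteq> 0" "tfun tau \<noteq> 1"
    and rs: "\<not> (2 * r \<in> \<int> \<and> 2 * s \<in> \<int>)"
  shows "denom r s tau \<noteq> 0"
proof
  assume 0: "denom r s tau = 0"
  let ?a = "of_real r + of_real s * tau"
  have a2: "2 * ?a \<notin> \<Lambda>"
    using rs combination_in_lattice_iff[of "2 * r" "2 * s"] by (simp add: algebra_simps)
  then have a1: "?a \<notin> \<Lambda>" using lattice_add[of ?a ?a] by (metis mult_2)
  have *: "\<exists>x y. ?a = c * (of_real x + of_real y * tau') \<and> 2 * x \<in> \<int>"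
    if c: "c \<noteq> 0" "\<Lambda> = (*) c ` lattice tau'" and tau': "Re tau' = 0" "Im tau' > 0" for c tau'
  proof -
    interpret lattice_similarity tau tau' c
      by unfold_locales (use c tau' Im_tau in auto)
    obtain x y where xy: "?a / c = of_real x + of_real y * tau'" by (rule L'.exists_combination)
    then have a: "?a = c * (of_real x + of_real y * tau')" using c(1) by (simp add: field_simps)
    have nl: "of_real x + of_real y * tau' \<notin> lattice tau'"
      using a1 mult_in_lattice_iff[of "of_real x + of_real y * tau'"] unfolding a by blast
    have "denom x y tau' = 0" using denom_similar[OF a nl] 0 c(1) by simp
    then have "2 * x \<in> \<int>" by (rule L'.denom_eq_0_imp[OF tau'(1) nl])
    then show ?thesis using a by blast
  qed
  obtain c b where c: "c \<noteq> 0" and b: "b > 0" and L: "\<Lambda> = (*) c ` lattice (\<i> * of_real b)"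
    using rectangular_if_tfun_real[OF t] by blast
  obtain x y where xy: "?a = c * (of_real x + of_real y * (\<i> * of_real b))" "2 * x \<in> \<int>"
    using *[OF c L] b by auto
  \<comment> \<open>The second basis starts with the other side of the rectangle. Its modulus is
    -1/(\<i> b) = \<i>/b.\<close>
  define d where "d = c * (\<i> * of_real b)"
  have d0: "d \<noteq> 0" using c b by (simp add: d_def)
  have "lattice (\<i> * of_real b) = (*) (\<i> * of_real b) ` lattice (\<i> * of_real (1 / b))"
  proof (intro equalityI subsetI)
    fix z assume "z \<in> lattice (\<i> * of_real b)"
    then obtain m n where "z = lat (\<i> * of_real b) (m, n)" by auto
    then have "z = \<i> * of_real b * lat (\<i> * of_real (1 / b)) (n, - m)"
      using b by (simp add: lat_eq complex_eq_iff)
    then show "z \<in> (*) (\<i> * of_real b) ` lattice (\<i> * of_real (1 / b))" by blast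
  next
    fix z assume "z \<in> (*) (\<i> * of_real b) ` lattice (\<i> * of_real (1 / b))"
    then obtain m n where "z = \<i> * of_real b * lat (\<i> * of_real (1 / b)) (m, n)" by auto
    then have "z = lat (\<i> * of_real b) (- n, m)"
      using b by (simp add: lat_eq complex_eq_iff)
    then show "z \<in> lattice (\<i> * of_real b)" by blast
  qed
  then have L': "\<Lambda> = (*) d ` lattice (\<i> * of_real (1 / b))"
    unfolding L d_def by (simp add: image_image mult.assoc)
  obtain x' y' where xy': "?a = d * (of_real x' + of_real y' * (\<i> * of_real (1 / b)))" "2 * x' \<in> \<int>"
    using *[OF d0 L'] b by auto
  \<comment> \<open>The imaginary parts identify the first coordinate in the new basis with the
    second one in the old basis.\<close>
  have "of_real x + of_real y * (\<i> * of_real b) = \<i> * of_real b * (of_real x' + of_real y' * (\<i> * of_real (1 / b)))"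
    using xy(1) xy'(1) c by (simp add: d_def mult.assoc)
  then have "y = x'" using b by (simp add: complex_eq_iff)
  interpret B: upper_half_plane "\<i> * of_real b" by unfold_locales (use b in simp)
  have "of_real (2 * x) + of_real (2 * y) * (\<i> * of_real b) \<in> lattice (\<i> * of_real b)"
    unfolding B.combination_in_lattice_iff using xy(2) xy'(2) \<open>y = x'\<close> by simp
  then have "c * (of_real (2 * x) + of_real (2 * y) * (\<i> * of_real b)) \<in> \<Lambda>" unfolding L by blast
  moreover have "c * (of_real (2 * x) + of_real (2 * y) * (\<i> * of_real b)) = 2 * ?a"
    unfolding xy(1) by (simp add: algebra_simps)
  ultimately show False using a2 by simp
qed

end

section \<open>Continuity in the modulus\<close>

text \<open>The majorant is written in the integer coordinates and not in the lattice vectors, so it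
  is the same for all moduli in \<open>U\<close> and the M-test gives uniform convergence.\<close>

lemma continuous_on_infsum_lat:
  fixes f :: "int \<times> int \<Rightarrow> 'a::topological_space \<Rightarrow> complex"
  assumes "\<And>p. p \<in> UNIV - {(0,0)} \<Longrightarrow> continuous_on U (f p)"
    and "\<And>p x. p \<in> UNIV - {(0,0)} \<Longrightarrow> x \<in> U \<Longrightarrow>
      norm (f p x) \<le> C * (1 / (\<bar>real_of_int (fst p)\<bar> + \<bar>real_of_int (snd p)\<bar>) ^ 3)"
  shows "continuous_on U (\<lambda>x. infsum (\<lambda>p. f p x) (UNIV - {(0,0)}))"
proof (rule uniform_limit_theorem)
  show "uniform_limit U (\<lambda>X x. \<Sum>p\<in>X. f p x) (\<lambda>x. infsum (\<lambda>p. f p x) (UNIV - {(0,0)}))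
      (finite_subsets_at_top (UNIV - {(0,0)}))"
    by (rule Weierstrass_m_test_general[OF assms(2)
          summable_on_cmult_right[OF summable_on_inverse_cube_l1_norm]])
  show "\<forall>\<^sub>F X in finite_subsets_at_top (UNIV - {(0,0)}). continuous_on U (\<lambda>x. \<Sum>p\<in>X. f p x)"
    by (rule eventually_finite_subsets_at_top_weakI) (auto intro!: continuous_on_sum assms(1))
qed auto

section \<open>Estimates uniform in a neighbourhood of the modulus\<close>

context upper_half_plane
begin

text \<open>The radius keeps imaginary parts above Im tau / 2, which keeps the comparison with the
  l1 norm uniform; \<open>nbhd_sep\<close> is \<open>sep\<close> with these worst-case
  bounds.\<close>

definition nbhd :: "complex set" where "nbhd = ball tau (Im tau / 2)"

definition nbhd_sep :: real where
  "nbhd_sep = 1 / (1 + (norm tau + Im tau / 2 + 1) / (Im tau / 2))"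

lemma nbhd_sep_pos: "nbhd_sep > 0"
  unfolding nbhd_sep_def using Im_tau
  by (intro divide_pos_pos add_pos_nonneg divide_nonneg_pos) (auto simp: add_nonneg_nonneg)

lemma nbhd_open: "open nbhd" and tau_in_nbhd: "tau \<in> nbhd"
  using Im_tau by (simp_all add: nbhd_def)

lemma
  assumes "t \<in> nbhd"
  shows Im_nbhd: "Im t \<ge> Im tau / 2" and norm_nbhd: "norm t \<le> norm tau + Im tau / 2"
proof -
  have d: "norm (tau - t) < Im tau / 2" using assms by (simp add: nbhd_def dist_norm)
  then show "Im t \<ge> Im tau / 2" using abs_Im_le_cmod[of "tau - t"] by simp
  show "norm t \<le> norm tau + Im tau / 2"
    using d norm_triangle_ineq2[of t tau] by (simp add: norm_minus_commute)
qed

lemma nbhd_upper: "t \<in> nbhd \<Longrightarrow> upper_half_plane t"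
  using Im_nbhd[of t] Im_tau by unfold_locales linarith

lemma nbhd_sep_bound:
  assumes "t \<in> nbhd"
  shows "nbhd_sep * (\<bar>x\<bar> + \<bar>y\<bar>) \<le> norm (of_real x + of_real y * t)"
proof -
  let ?D = "1 + (norm tau + Im tau / 2 + 1) / (Im tau / 2)"
  have pos: "?D > 0" using Im_tau
    by (intro add_pos_nonneg divide_nonneg_pos) (auto simp: add_nonneg_nonneg)
  have "\<bar>x\<bar> + \<bar>y\<bar> \<le> ?D * norm (of_real x + of_real y * t)"
    using Im_tau Im_nbhd[OF assms] norm_nbhd[OF assms] by (intro l1_norm_le_norm_combination) auto
  then show ?thesis using pos by (simp add: nbhd_sep_def pos_divide_le_eq mult.commute)
qed

text \<open>The separation of the point from nonzero lattice points is transferred to its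
  coordinates (r, s). The modulus no longer occurs there, so the constant found at
  \<open>tau\<close> serves for every modulus in \<open>nbhd\<close>.\<close>

lemma l1_separation:
  assumes "of_real r + of_real s * tau \<notin> \<Lambda>"
  obtains k where "k > 0"
    "\<And>m n. (m, n) \<noteq> (0, 0) \<Longrightarrow>
      k * (\<bar>real_of_int m\<bar> + \<bar>real_of_int n\<bar>) \<le> \<bar>r - real_of_int m\<bar> + \<bar>s - real_of_int n\<bar>"
proof -
  let ?a = "of_real r + of_real s * tau"
  obtain \<rho> c where \<rho>: "\<rho> > 0" and c: "c > 0"
    and sep': "\<And>w p. w \<in> ball ?a \<rho> \<Longrightarrow> p \<in> I\<^sub>0 \<Longrightarrow> c * norm (lat tau p) \<le> norm (w - lat tau p)"
    using nonzero_lattice_separation[of ?a] assms by blast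
  define B where "B = 1 + norm tau"
  have B: "B > 0" by (simp add: B_def add_pos_nonneg)
  have "(c * sep / B) * (\<bar>real_of_int m\<bar> + \<bar>real_of_int n\<bar>) \<le> \<bar>r - real_of_int m\<bar> + \<bar>s - real_of_int n\<bar>"
    if "(m, n) \<noteq> (0, 0)" for m n
  proof -
    let ?x = "r - real_of_int m" and ?y = "s - real_of_int n"
    have "c * (sep * (\<bar>real_of_int m\<bar> + \<bar>real_of_int n\<bar>)) \<le> c * norm (lat tau (m, n))"
      using sep_bound[of "of_int m" "of_int n"] c by (intro mult_left_mono) (auto simp: lat_eq)
    also have "\<dots> \<le> norm (?a - lat tau (m, n))" using that \<rho> by (intro sep') auto
    also have "?a - lat tau (m, n) = of_real ?x + of_real ?y * tau"
      by (simp add: lat_eq algebra_simps)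
    also have "norm \<dots> \<le> \<bar>?x\<bar> + \<bar>?y\<bar> * norm tau"
      by (rule order_trans[OF norm_triangle_ineq]) (simp add: norm_mult flip: of_real_diff)
    also have "\<dots> \<le> B * (\<bar>?x\<bar> + \<bar>?y\<bar>)"
    proof -
      have "0 \<le> \<bar>?x\<bar> * norm tau" by simp
      then show ?thesis by (simp add: B_def algebra_simps)
    qed
    finally show ?thesis using B by (simp add: field_simps)
  qed
  moreover have "c * sep / B > 0" using c sep_pos B by simp
  ultimately show ?thesis using that by blast
qed

text \<open>The point keeps its coordinates r, s while the modulus moves, so its distance to every
  nonzero lattice point stays comparable to the l1 norm of that lattice point. All three series are
  then dominated by the inverse cubes.\<close>

lemma
  assumes rs: "of_real r + of_real s * tau \<notin> \<Lambda>"
  shows isCont_wzeta: "isCont (\<lambda>t. wzeta t (of_real r + of_real s * t)) tau"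
    and isCont_wp: "isCont (\<lambda>t. wp t (of_real r + of_real s * t)) tau"
    and isCont_wp': "isCont (\<lambda>t. wp' t (of_real r + of_real s * t)) tau"
proof -
  define a where "a = (\<lambda>t::complex. of_real r + of_real s * t)"
  obtain k where k: "k > 0"
    and kb: "\<And>m n. (m, n) \<noteq> (0, 0) \<Longrightarrow>
      k * (\<bar>real_of_int m\<bar> + \<bar>real_of_int n\<bar>) \<le> \<bar>r - real_of_int m\<bar> + \<bar>s - real_of_int n\<bar>"
    using l1_separation[OF rs] by blast
  \<comment> \<open>One constant bounds both \<open>lat t p\<close> and \<open>a t - lat t p\<close>
    from below, so that \<open>b3\<close> can treat any product of three such factors.\<close>
  define c where "c = min nbhd_sep (nbhd_sep * k)"
  have c: "c > 0" using k nbhd_sep_pos by (simp add: c_def)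
  let ?N = "\<lambda>p::int\<times>int. \<bar>real_of_int (fst p)\<bar> + \<bar>real_of_int (snd p)\<bar>"
  have N: "?N p > 0" if "p \<in> I\<^sub>0" for p
    using that by (cases p) auto
  have l: "c * ?N p \<le> norm (lat t p)" if "t \<in> nbhd" for t p
  proof -
    have "c * ?N p \<le> nbhd_sep * ?N p" unfolding c_def by (intro mult_right_mono) auto
    also have "\<dots> \<le> norm (lat t p)"
      using nbhd_sep_bound[OF that, of "of_int (fst p)" "of_int (snd p)"] by (simp add: lat_def)
    finally show ?thesis .
  qed
  have al: "c * ?N p \<le> norm (a t - lat t p)" if t: "t \<in> nbhd" and p: "p \<in> I\<^sub>0" for t p
  proof -
    have "c * ?N p \<le> (nbhd_sep * k) * ?N p" unfolding c_def by (intro mult_right_mono) auto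
    also have "\<dots> \<le> nbhd_sep * (\<bar>r - real_of_int (fst p)\<bar> + \<bar>s - real_of_int (snd p)\<bar>)"
      unfolding mult.assoc using p nbhd_sep_pos by (intro mult_left_mono kb) (auto simp: prod_eq_iff)
    also have "\<dots> \<le> norm (of_real (r - real_of_int (fst p)) + of_real (s - real_of_int (snd p)) * t)"
      by (rule nbhd_sep_bound[OF t])
    also have "of_real (r - real_of_int (fst p)) + of_real (s - real_of_int (snd p)) * t = a t - lat t p"
      by (simp add: a_def lat_def algebra_simps)
    finally show ?thesis .
  qed
  have cN: "c * ?N p > 0" if "p \<in> I\<^sub>0" for p using N[OF that] c by simp
  have l0: "lat t p \<noteq> 0" if "t \<in> nbhd" "p \<in> I\<^sub>0" for t p
    using l[OF that(1), of p] cN[OF that(2)] by auto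
  have al0: "a t - lat t p \<noteq> 0" if "t \<in> nbhd" "p \<in> I\<^sub>0" for t p
    using al[OF that] cN[OF that(2)] by (metis norm_zero not_le)
  define \<rho> where "\<rho> = \<bar>r\<bar> + \<bar>s\<bar> * (norm tau + Im tau / 2)"
  have \<rho>: "norm (a t) \<le> \<rho>" if "t \<in> nbhd" for t
  proof -
    have "norm (a t) \<le> \<bar>r\<bar> + \<bar>s\<bar> * norm t"
      unfolding a_def by (rule order_trans[OF norm_triangle_ineq]) (simp add: norm_mult)
    also have "\<dots> \<le> \<rho>" unfolding \<rho>_def
      by (intro add_left_mono mult_left_mono norm_nbhd[OF that]) auto
    finally show ?thesis .
  qed
  have b3: "norm (x / (y1 * y2 * y3)) \<le> (X / c ^ 3) * (1 / ?N p ^ 3)"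
    if "p \<in> I\<^sub>0" "norm x \<le> X" "c * ?N p \<le> norm y1" "c * ?N p \<le> norm y2" "c * ?N p \<le> norm y3"
    for p x X and y1 y2 y3 :: complex
  proof -
    note pos = cN[OF that(1)]
    have X: "X \<ge> 0" using that(2) norm_ge_zero[of x] by linarith
    have "norm (x / (y1 * y2 * y3)) = norm x / (norm y1 * norm y2 * norm y3)"
      by (simp add: norm_divide norm_mult)
    also have "\<dots> \<le> X / ((c * ?N p) * (c * ?N p) * (c * ?N p))"
    proof (rule frac_le)
      show "(c * ?N p) * (c * ?N p) * (c * ?N p) \<le> norm y1 * norm y2 * norm y3"
        using that pos by (intro mult_mono) (auto intro!: mult_nonneg_nonneg simp: less_imp_le[OF c])
    qed (use that X pos in auto)
    also have "\<dots> = (X / c ^ 3) * (1 / ?N p ^ 3)"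
      by (simp add: power3_eq_cube mult_ac)
    finally show ?thesis .
  qed
  have ca: "continuous_on nbhd a" and cl: "continuous_on nbhd (\<lambda>t. lat t p)" for p
    unfolding a_def lat_def by (intro continuous_intros)+
  have a0: "a t \<noteq> 0" if "t \<in> nbhd" for t
  proof
    assume "a t = 0"
    then have "nbhd_sep * (\<bar>r\<bar> + \<bar>s\<bar>) \<le> 0" using nbhd_sep_bound[OF that, of r s] by (simp add: a_def)
    then have "r = 0" "s = 0" using nbhd_sep_pos by (auto simp: mult_le_0_iff)
    then show False using rs zero_in_lattice by simp
  qed
  have c1: "continuous_on nbhd (\<lambda>t. infsum (\<lambda>p. 1 / (a t - lat t p) + 1 / lat t p + a t / (lat t p)^2) I\<^sub>0)"
  proof (rule continuous_on_infsum_lat)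
    show "continuous_on nbhd (\<lambda>t. 1 / (a t - lat t p) + 1 / lat t p + a t / (lat t p)^2)" if "p \<in> I\<^sub>0" for p
      using l0 al0 that by (intro continuous_intros ca cl) auto
    fix p t assume p: "p \<in> I\<^sub>0" and t: "t \<in> nbhd"
    have "1 / (a t - lat t p) + 1 / lat t p + a t / (lat t p)^2 = (a t)^2 / (lat t p * lat t p * (a t - lat t p))"
      using al0[OF t p] l0[OF t p] by (simp add: field_simps power2_eq_square)
    also have "norm \<dots> \<le> (\<rho>^2 / c ^ 3) * (1 / ?N p ^ 3)"
      using \<rho>[OF t] l[OF t, of p] al[OF t p] p
      by (intro b3) (auto simp: norm_power intro!: power_mono)
    finally show "norm (1 / (a t - lat t p) + 1 / lat t p + a t / (lat t p)^2) \<le> (\<rho>^2 / c ^ 3) * (1 / ?N p ^ 3)" .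
  qed
  have c2: "continuous_on nbhd (\<lambda>t. infsum (\<lambda>p. 1 / (a t - lat t p)^2 - 1 / (lat t p)^2) I\<^sub>0)"
  proof (rule continuous_on_infsum_lat)
    show "continuous_on nbhd (\<lambda>t. 1 / (a t - lat t p)^2 - 1 / (lat t p)^2)" if "p \<in> I\<^sub>0" for p
      using l0 al0 that by (intro continuous_intros ca cl) auto
    fix p t assume p: "p \<in> I\<^sub>0" and t: "t \<in> nbhd"
    let ?u = "a t - lat t p" and ?v = "lat t p"
    \<comment> \<open>The difference of squares is split so that each fraction has exactly three
      linear factors below and x + y = \<open>a t\<close>, which is bounded, above.\<close>
    have "1 / x^2 - 1 / y^2 = (x + y) / (y * x * x) + (- (x + y)) / (y * y * x)"
      if "x \<noteq> 0" "y \<noteq> 0" for x y :: complex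
      using that by (simp add: divide_simps) (simp add: power2_eq_square algebra_simps)
    from this[OF al0[OF t p] l0[OF t p]]
    have eq: "1 / ?u^2 - 1 / ?v^2 = a t / (?v * ?u * ?u) + (- a t) / (?v * ?v * ?u)" by simp
    have "norm (a t / (?v * ?u * ?u)) \<le> (\<rho> / c ^ 3) * (1 / ?N p ^ 3)"
      "norm ((- a t) / (?v * ?v * ?u)) \<le> (\<rho> / c ^ 3) * (1 / ?N p ^ 3)"
      using \<rho>[OF t] l[OF t, of p] al[OF t p] p by (intro b3; simp)+
    then have "norm (a t / (?v * ?u * ?u) + (- a t) / (?v * ?v * ?u)) \<le>
        (\<rho> / c ^ 3) * (1 / ?N p ^ 3) + (\<rho> / c ^ 3) * (1 / ?N p ^ 3)"
      by (rule norm_triangle_mono)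
    then show "norm (1 / ?u^2 - 1 / ?v^2) \<le> (2 * \<rho> / c ^ 3) * (1 / ?N p ^ 3)"
      unfolding eq by simp
  qed
  have c3: "continuous_on nbhd (\<lambda>t. infsum (\<lambda>p. - 2 / (a t - lat t p)^3) I\<^sub>0)"
  proof (rule continuous_on_infsum_lat)
    show "continuous_on nbhd (\<lambda>t. - 2 / (a t - lat t p)^3)" if "p \<in> I\<^sub>0" for p
      using l0 al0 that by (intro continuous_intros ca cl) auto
    fix p t assume p: "p \<in> I\<^sub>0" and t: "t \<in> nbhd"
    have "norm (- 2 / ((a t - lat t p) * (a t - lat t p) * (a t - lat t p))) \<le> (2 / c ^ 3) * (1 / ?N p ^ 3)"
      using al[OF t p] p by (intro b3) auto
    then show "norm (- 2 / (a t - lat t p)^3) \<le> (2 / c ^ 3) * (1 / ?N p ^ 3)"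
      by (simp add: power3_eq_cube)
  qed
  have iC: "isCont f tau" if "continuous_on nbhd f" for f :: "complex \<Rightarrow> complex"
    using that nbhd_open tau_in_nbhd by (simp add: continuous_on_eq_continuous_at)
  have "continuous_on nbhd (\<lambda>t. wzeta t (a t))"
    unfolding wzeta_def using a0 by (intro continuous_intros ca c1) auto
  from iC[OF this] show "isCont (\<lambda>t. wzeta t (of_real r + of_real s * t)) tau" by (simp add: a_def)
  have "continuous_on nbhd (\<lambda>t. wp t (a t))"
    unfolding wp_def using a0 by (intro continuous_intros ca c2) auto
  from iC[OF this] show "isCont (\<lambda>t. wp t (of_real r + of_real s * t)) tau" by (simp add: a_def)
  have "continuous_on nbhd (\<lambda>t. - 2 / (a t)^3 + infsum (\<lambda>p. - 2 / (a t - lat t p)^3) I\<^sub>0)"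
    using a0 by (intro continuous_intros ca c3) auto
  moreover have "- 2 / (a t)^3 + infsum (\<lambda>p. - 2 / (a t - lat t p)^3) I\<^sub>0 = wp' t (a t)" if t: "t \<in> nbhd" for t
  proof -
    interpret T: upper_half_plane t by (rule nbhd_upper[OF t])
    have "a t \<notin> lattice t"
      using rs by (simp only: a_def T.combination_in_lattice_iff combination_in_lattice_iff not_False_eq_True)
    then show ?thesis by (simp add: T.wp'_eq T.wp_reg'_def)
  qed
  ultimately have "continuous_on nbhd (\<lambda>t. wp' t (a t))" by (simp cong: continuous_on_cong)
  from iC[OF this] show "isCont (\<lambda>t. wp' t (of_real r + of_real s * t)) tau" by (simp add: a_def)
qed

lemma isCont_g2: "isCont g2 tau"
proof -
  let ?N = "\<lambda>p::int\<times>int. \<bar>real_of_int (fst p)\<bar> + \<bar>real_of_int (snd p)\<bar>"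
  define c where "c = nbhd_sep"
  have c: "c > 0" unfolding c_def by (rule nbhd_sep_pos)
  have l: "c * ?N p \<le> norm (lat t p)" if "t \<in> nbhd" for t p
    using nbhd_sep_bound[OF that, of "of_int (fst p)" "of_int (snd p)"] by (simp add: lat_def c_def)
  have N: "?N p \<ge> 1" if "p \<in> I\<^sub>0" for p
  proof -
    have "1 \<le> \<bar>fst p\<bar> + \<bar>snd p\<bar>" using that by (cases p) auto
    then show ?thesis by linarith
  qed
  have "continuous_on nbhd (\<lambda>t. infsum (\<lambda>p. 1 / (lat t p)^4) I\<^sub>0)"
  proof (rule continuous_on_infsum_lat)
    fix p assume p: "p \<in> I\<^sub>0"
    have "lat t p \<noteq> 0" if "t \<in> nbhd" for t
      using l[OF that, of p] N[OF p] c by (metis mult_pos_pos norm_zero not_le not_one_le_zero order_less_le_trans zero_less_one)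
    then show "continuous_on nbhd (\<lambda>t. 1 / (lat t p)^4)"
      unfolding lat_def by (intro continuous_intros) auto
    fix t assume t: "t \<in> nbhd"
    have "norm (1 / (lat t p)^4) = 1 / norm (lat t p) ^ 4" by (simp add: norm_divide norm_power)
    also have "\<dots> \<le> 1 / (c * ?N p) ^ 4"
      using l[OF t, of p] N[OF p] c by (intro frac_le power_mono) auto
    also have "\<dots> = (1 / c ^ 4) * (1 / ?N p ^ 4)" by (simp add: power_mult_distrib)
    also have "\<dots> \<le> (1 / c ^ 4) * (1 / ?N p ^ 3)"
      using N[OF p] c by (intro mult_left_mono frac_le power_increasing) auto
    finally show "norm (1 / (lat t p)^4) \<le> (1 / c ^ 4) * (1 / ?N p ^ 3)" .
  qed
  then have "continuous_on nbhd g2" unfolding g2_def by (intro continuous_intros)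
  then show ?thesis using nbhd_open tau_in_nbhd by (simp add: continuous_on_eq_continuous_at)
qed

text \<open>The quasi-periods are differences of zeta values at the points with fixed coordinates
  (\<plusminus>1/2, 0) and (0, \<plusminus>1/2).\<close>

lemma isCont_eta1: "isCont eta1 tau" and isCont_eta2: "isCont eta2 tau"
proof -
  have "isCont (\<lambda>t. wzeta t (of_real (1/2) + of_real 0 * t) - wzeta t (of_real (-1/2) + of_real 0 * t)) tau"
    using half_not_in_lattice(1) lattice_minus_iff[of "1/2"] by (intro continuous_intros isCont_wzeta) auto
  then show "isCont eta1 tau" unfolding eta1_def by simp
  have "isCont (\<lambda>t. wzeta t (of_real 0 + of_real (1/2) * t) - wzeta t (of_real 0 + of_real (-1/2) * t)) tau"
    using half_not_in_lattice(2) lattice_minus_iff[of "tau/2"] by (intro continuous_intros isCont_wzeta) auto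
  then show "isCont eta2 tau" unfolding eta2_def by simp
qed

lemma isCont_wp_p:
  assumes "of_real r + of_real s * tau \<notin> \<Lambda>" "denom r s tau \<noteq> 0"
  shows "isCont (wp_p r s) tau"
proof -
  have Z: "isCont (Zrs r s) tau"
    unfolding Zrs_def by (intro continuous_intros isCont_wzeta isCont_eta1 isCont_eta2 assms)
  have "2 * denom r s tau \<noteq> 0" using assms(2) by simp
  then show ?thesis
    unfolding wp_p_def denom_def Let_def
    by (intro continuous_intros isCont_wp isCont_wp' isCont_g2 Z assms)
qed

end

text \<open>Absence of a pole is expressed by a finite limit, because the value of a quotient is
  finite in HOL even where its denominator vanishes. The limit obtained is the value of
  \<open>wp_p\<close> itself, by continuity.\<close>

theorem theorem1p1:
  fixes r s :: real and tau0 :: complex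
  assumes "\<not> (2 * r \<in> \<int> \<and> 2 * s \<in> \<int>)"
    and "Im tau0 > 0"
    and "tfun tau0 \<in> \<real>" and "tfun tau0 \<noteq> 0" and "tfun tau0 \<noteq> 1"
  shows "\<exists>L. (wp_p r s \<longlongrightarrow> L) (at tau0)"
proof -
  interpret upper_half_plane tau0 by unfold_locales (rule assms(2))
  have "\<not> (r \<in> \<int> \<and> s \<in> \<int>)" using assms(1) by auto
  then have "of_real r + of_real s * tau0 \<notin> lattice tau0"
    by (simp only: combination_in_lattice_iff not_False_eq_True)
  then have "isCont (wp_p r s) tau0"
    using denom_nonzero[OF assms(3,4,5,1)] by (rule isCont_wp_p)
  then show ?thesis unfolding isCont_def by blast
qed

end
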